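(* Let $A_0, A_1,\ldots,A_m$ be constant real symmetric matrices of size $N_0\times N_0$, and for $k=1,\ldots,m$ let $B_k(x) = B_0^{(k)} + x_1 B_1^{(k)} + \cdots + x_n B_n^{(k)}$, where $B_0^{(k)},\ldots,B_n^{(k)}$ are constant real symmetric $N_k\times N_k$ matrices. Let $$\mathcal{C} = \Big\{ (x,d)\in\mathbb{R}^n\times\mathbb{R} \;:\; d\cdot A_0 + \sum_{k=1}^m t_k A_k \succeq 0 \ \text{ whenever } \ \lambda_{\min}(B_k(x)) \le t_k \le \lambda_{\max}(B_k(x)) \ \text{ for } k=1,\ldots,m \Big\}.$$ Then the convex semialgebraic set $\mathcal{C}\subset\mathbb{R}^{n+1}$ is a spectrahedron, and it can be represented by the linear matrix inequality $$\mathcal{C} = \big\{ (x,d)\in\mathbb{R}^n\times\mathbb{R} \;:\; \mathcal{L}(x,d)\succeq 0 \big\},$$ where $\mathcal{L}(x,d)$ is the symmetric linear matrix polynomial of size $N_0N_1\cdots N_m$ constructed from the $A_i$ and $B_k(x)$ as described in the context.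
   Context: For a real symmetric matrix $M$, $M\succeq 0$ means $M$ is positive semidefinite, and $\lambda_{\min}(M),\lambda_{\max}(M)$ denote its smallest and largest eigenvalues. A spectrahedron is the solution set of a linear matrix inequality (LMI), i.e. a set of the form $\{z\in\mathbb{R}^s : F_0+z_1F_1+\cdots+z_sF_s\succeq 0\}$ with constant real symmetric matrices $F_i$ of equal size. For square matrices $F$ ($r\times r$) and $G$ ($s\times s$), the tensor (Kronecker) product is the $rs\times rs$ block matrix $F\otimes G = (F_{ij}G)_{1\le i,j\le r}$, and the tensor (Kronecker) sum is $F\oplus G = F\otimes I_s + I_r\otimes G$. Both operations are associative. Let $a=(a_0,a_1,\ldots,a_m)$ be unknowns. For a linear matrix polynomial $P_a(x,d) = a_0P_0(x,d)+a_1P_1(x,d)+\cdots+a_mP_m(x,d)$ in $a$, whose coefficients $P_i(x,d)$ are matrix polynomials in $(x,d)$, define $$\mathcal{A}(P_a(x,d)) = P_0(x,d)\otimes A_0 + P_1(x,d)\otimes A_1+\cdots+P_m(x,d)\otimes A_m .$$ Define $L_a(x,d) = (d a_0)\oplus (a_1B_1(x))\oplus\cdots\oplus(a_mB_m(x))$, where $(da_0)$ is a $1\times 1$ matrix; this is linear in $a$. Then $$\mathcal{L}(x,d) := \mathcal{A}(L_a(x,d)).$$ Its entries are linear polynomials (possibly with constant term) in $(x,d)$. *)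

theory Defs
  imports "HOL-Analysis.Analysis" "Jordan_Normal_Form.Spectral_Radius"
begin

definition sym_mat :: "nat \<Rightarrow> real mat \<Rightarrow> bool" where
  "sym_mat N M \<longleftrightarrow> M \<in> carrier_mat N N \<and> transpose_mat M = M"

definition psd :: "real mat \<Rightarrow> bool" where
  "psd M \<longleftrightarrow> sym_mat (dim_row M) M \<and>
     (\<forall>v \<in> carrier_vec (dim_row M). 0 \<le> scalar_prod v (M *\<^sub>v v))"

text \<open>
  The next two are meant for real symmetric matrices of positive size, whose real spectrum is
  finite and nonempty.
\<close>

definition lambda_min :: "real mat \<Rightarrow> real" where
  "lambda_min M = Min (spectrum M)"

definition lambda_max :: "real mat \<Rightarrow> real" where
  "lambda_max M = Max (spectrum M)"

text \<open>
  The type of matrices of all sizes is not a commutative monoid, so the sum over a finite index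
  set of \<open>N \<times> N\<close> matrices is taken entrywise.
\<close>

definition mat_sum :: "nat \<Rightarrow> ('i \<Rightarrow> real mat) \<Rightarrow> 'i set \<Rightarrow> real mat" where
  "mat_sum N F I = mat N N (\<lambda>ij. \<Sum>k\<in>I. F k $$ ij)"

definition kron :: "real mat \<Rightarrow> real mat \<Rightarrow> real mat" where
  "kron F G = mat (dim_row F * dim_row G) (dim_col F * dim_col G)
     (\<lambda>(i, j). F $$ (i div dim_row G, j div dim_col G) * G $$ (i mod dim_row G, j mod dim_col G))"

definition kron_sum :: "real mat \<Rightarrow> real mat \<Rightarrow> real mat" where
  "kron_sum F G = kron F (1\<^sub>m (dim_row G)) + kron (1\<^sub>m (dim_row F)) G"

text \<open>
  Symmetric linear matrix polynomials of size \<open>N\<close> (constant term allowed) in the coordinates of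
  a Euclidean space, as functions of the point.
\<close>

definition sym_linear_matrix_poly :: "nat \<Rightarrow> ('a::euclidean_space \<Rightarrow> real mat) \<Rightarrow> bool" where
  "sym_linear_matrix_poly N L \<longleftrightarrow> (\<exists>F0 F. sym_mat N F0 \<and> (\<forall>b\<in>Basis. sym_mat N (F b)) \<and>
     (\<forall>z. L z = F0 + mat_sum N (\<lambda>b. inner z b \<cdot>\<^sub>m F b) Basis))"

definition spectrahedron :: "'a::euclidean_space set \<Rightarrow> bool" where
  "spectrahedron S \<longleftrightarrow> (\<exists>N L. sym_linear_matrix_poly N L \<and> S = {z. psd (L z)})"

text \<open>Semialgebraic sets: the Boolean algebra generated by strict polynomial inequalities.\<close>

inductive semialgebraic :: "'a::euclidean_space set \<Rightarrow> bool" where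
  "real_polynomial_function p \<Longrightarrow> semialgebraic {z. p z > 0}"
| "semialgebraic S \<Longrightarrow> semialgebraic (- S)"
| "semialgebraic S \<Longrightarrow> semialgebraic T \<Longrightarrow> semialgebraic (S \<union> T)"
| "semialgebraic S \<Longrightarrow> semialgebraic T \<Longrightarrow> semialgebraic (S \<inter> T)"

text \<open>\<open>B_0 + x_1 B_1 + \<cdots> + x_n B_n\<close>, the \<open>n\<close> coordinates being indexed by the type \<open>'n\<close>.\<close>

definition pencil :: "nat \<Rightarrow> real mat \<Rightarrow> ('n::finite \<Rightarrow> real mat) \<Rightarrow> real ^ 'n \<Rightarrow> real mat" where
  "pencil N B0 B x = B0 + mat_sum N (\<lambda>i. vec_nth x i \<cdot>\<^sub>m B i) UNIV"

text \<open>
  A homogeneous linear matrix polynomial \<open>P_a = a_0 P_0 + \<cdots> + a_m P_m\<close> of size \<open>M\<close> is represented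
  by the map \<open>P\<close> sending a value of \<open>a\<close> to the matrix \<open>P_a\<close>.  Its coefficient \<open>P_i\<close> is then the
  value of \<open>P\<close> at the \<open>i\<close>-th unit vector (see \<open>tensor_subst_eq\<close>), and \<open>tensor_subst\<close> replaces
  the unknowns \<open>a_i\<close> by the matrices \<open>A_i\<close> of size \<open>K\<close>.
\<close>

definition unit_assignment :: "nat \<Rightarrow> nat \<Rightarrow> real" where
  "unit_assignment i = (\<lambda>k. if k = i then 1 else 0)"

definition tensor_subst ::
  "nat \<Rightarrow> nat \<Rightarrow> nat \<Rightarrow> (nat \<Rightarrow> real mat) \<Rightarrow> ((nat \<Rightarrow> real) \<Rightarrow> real mat) \<Rightarrow> real mat" where
  "tensor_subst M K m A P = mat_sum (M * K) (\<lambda>i. kron (P (unit_assignment i)) (A i)) {0..m}"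

lemma tensor_subst_eq:
  assumes "\<And>i. i \<le> m \<Longrightarrow> Q i \<in> carrier_mat M M"
    and P: "\<And>a. P a = mat_sum M (\<lambda>i. a i \<cdot>\<^sub>m Q i) {0..m}"
  shows "tensor_subst M K m A P = mat_sum (M * K) (\<lambda>i. kron (Q i) (A i)) {0..m}"
proof -
  have "P (unit_assignment i) = Q i" if i: "i \<le> m" for i
  proof (rule eq_matI)
    fix r c assume rc: "r < dim_row (Q i)" "c < dim_col (Q i)"
    have car: "dim_row (Q k) = M" "dim_col (Q k) = M" if "k \<le> m" for k
      using assms(1)[OF that] by auto
    have "P (unit_assignment i) $$ (r, c) = (\<Sum>k\<in>{0..m}. if k = i then Q k $$ (r, c) else 0)"
    proof -
      have "r < M" "c < M"
        using rc car[OF i] by auto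
      then have "P (unit_assignment i) $$ (r, c)
          = (\<Sum>k\<in>{0..m}. (unit_assignment i k \<cdot>\<^sub>m Q k) $$ (r, c))"
        unfolding P mat_sum_def by simp
      also have "\<dots> = (\<Sum>k\<in>{0..m}. if k = i then Q k $$ (r, c) else 0)"
        using \<open>r < M\<close> \<open>c < M\<close> by (intro sum.cong refl) (auto simp: car unit_assignment_def)
      finally show ?thesis .
    qed
    also have "\<dots> = Q i $$ (r, c)"
      using i by simp
    finally show "P (unit_assignment i) $$ (r, c) = Q i $$ (r, c)" .
  qed (use assms(1)[OF i] in \<open>auto simp: P mat_sum_def\<close>)
  then show ?thesis
    unfolding tensor_subst_def mat_sum_def
    by (intro arg_cong[of _ _ "mat (M * K) (M * K)"] ext sum.cong) auto
qed

text \<open>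
  \<open>L_a(x,d) = (d a_0) \<oplus> (a_1 B_1(x)) \<oplus> \<cdots> \<oplus> (a_m B_m(x))\<close>, where the argument \<open>Bx k\<close> stands for
  \<open>B_k(x)\<close> and the first summand is a \<open>1 \<times> 1\<close> matrix.
\<close>

definition L_form :: "nat \<Rightarrow> (nat \<Rightarrow> real mat) \<Rightarrow> real \<Rightarrow> (nat \<Rightarrow> real) \<Rightarrow> real mat" where
  "L_form m Bx d a =
     foldl kron_sum (mat 1 1 (\<lambda>_. d * a 0)) (map (\<lambda>k. a k \<cdot>\<^sub>m Bx k) [1..<Suc m])"

definition L_lmi ::
  "nat \<Rightarrow> (nat \<Rightarrow> nat) \<Rightarrow> (nat \<Rightarrow> real mat) \<Rightarrow> (nat \<Rightarrow> real mat) \<Rightarrow> (nat \<Rightarrow> 'n::finite \<Rightarrow> real mat)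
    \<Rightarrow> (real ^ 'n) \<times> real \<Rightarrow> real mat" where
  "L_lmi m N A B0 B = (\<lambda>(x, d).
     tensor_subst (\<Prod>k=1..m. N k) (N 0) m A (L_form m (\<lambda>k. pencil (N k) (B0 k) (B k) x) d))"

definition C_set ::
  "nat \<Rightarrow> (nat \<Rightarrow> nat) \<Rightarrow> (nat \<Rightarrow> real mat) \<Rightarrow> (nat \<Rightarrow> real mat) \<Rightarrow> (nat \<Rightarrow> 'n::finite \<Rightarrow> real mat)
    \<Rightarrow> ((real ^ 'n) \<times> real) set" where
  "C_set m N A B0 B = {(x, d). \<forall>t :: nat \<Rightarrow> real.
     (\<forall>k\<in>{1..m}. lambda_min (pencil (N k) (B0 k) (B k) x) \<le> t k \<and>
                 t k \<le> lambda_max (pencil (N k) (B0 k) (B k) x)) \<longrightarrow>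
     psd (d \<cdot>\<^sub>m A 0 + mat_sum (N 0) (\<lambda>k. t k \<cdot>\<^sub>m A k) {1..m})}"

end

theory Submission
  imports Defs
begin

text \<open>
  An orthogonal change of basis diagonalizes one \<open>B\<^sub>k\<close> and turns \<open>1 \<otimes> F + B\<^sub>k \<otimes> A\<^sub>k\<close> into the block
  diagonal matrix with blocks \<open>F + \<lambda> A\<^sub>k\<close>, where \<open>\<lambda>\<close> runs over the eigenvalues of \<open>B\<^sub>k\<close>.  By convexity in
  \<open>\<lambda>\<close> these blocks are positive semidefinite iff \<open>F + t A\<^sub>k\<close> is so for all \<open>t\<close> between the extreme
  eigenvalues.  Stripping off the tensor factors \<open>B\<^sub>m, \<dots>, B\<^sub>1\<close> one by one replaces the linear matrix
  inequality by the quantified condition on \<open>t\<^sub>1, \<dots>, t\<^sub>m\<close>.  Semialgebraicity holds because a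
  real symmetric \<open>M\<close> is positive semidefinite iff all coefficients of \<open>det (X + M)\<close> are nonnegative.
\<close>

section \<open>Spectral theorem for real symmetric matrices\<close>

text \<open>In \<open>L_form\<close> the tensor factors stand to the left of \<open>A k\<close>, the
  last one adjacent to it, so associativity lets that factor be absorbed into the coefficients.
  Absorption replaces \<open>d \<cdot>\<^sub>m A 0\<close> by a matrix that need not be a multiple
  of the new coefficient at index 0, and it enlarges all other coefficients; hence the inductions
  run over an arbitrary constant term \<open>G\<close>, family \<open>A\<close> and size
  \<open>K\<close>. The change of basis is not carried out on the large matrices: quadratic forms
  are expanded into finite sums, where orthogonality enters as a resolution of the identity. For a
  fixed vector the form of \<open>F + t A\<close> is affine in \<open>t\<close>, so its minimum on
  an interval is attained at an endpoint. Since \<open>semialgebraic\<close> is quantifier-free,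
  positivity on all vectors has to be traded for finitely many polynomial inequalities. The
  polynomial \<open>char_poly (- M)\<close> serves because its roots are the negated
  eigenvalues.\<close>

lemma sym_matD:
  assumes "sym_mat n M"
  shows "M \<in> carrier_mat n n" "transpose_mat M = M"
  using assms by (auto simp: sym_mat_def)

lemma sym_matI:
  assumes "M \<in> carrier_mat n n" "\<And>i j. i < n \<Longrightarrow> j < n \<Longrightarrow> M $$ (i, j) = M $$ (j, i)"
  shows "sym_mat n M"
  using assms by (auto simp: sym_mat_def intro!: eq_matI)

lemma sym_mat_index:
  assumes "sym_mat n M" "i < n" "j < n"
  shows "M $$ (i, j) = M $$ (j, i)"
  using assms unfolding sym_mat_def by (metis carrier_matD index_transpose_mat(1))

lemma sym_mat_scalar_prod:
  assumes "sym_mat n M" "v \<in> carrier_vec n" "w \<in> carrier_vec n"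
  shows "scalar_prod v (M *\<^sub>v w) = scalar_prod w (M *\<^sub>v v)"
proof -
  have "scalar_prod v (M *\<^sub>v w) = scalar_prod (M *\<^sub>v v) w"
    using transpose_vec_mult_scalar[OF sym_matD(1)[OF assms(1)] assms(3,2)] sym_matD(2)[OF assms(1)]
    by simp
  also have "\<dots> = scalar_prod w (M *\<^sub>v v)"
    using assms(3) mult_mat_vec_carrier[OF sym_matD(1)[OF assms(1)] assms(2)]
    by (intro comm_scalar_prod)
  finally show ?thesis .
qed

lemma scalar_prod_self_eq_0:
  fixes v :: "real vec"
  assumes "v \<in> carrier_vec n"
  shows "scalar_prod v v = 0 \<longleftrightarrow> v = 0\<^sub>v n"
  using assms by (auto simp: scalar_prod_def sum_nonneg_eq_0_iff intro!: eq_vecI)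

lemma scalar_prod_self_nonneg: "0 \<le> scalar_prod v (v :: real vec)"
  by (auto simp: scalar_prod_def intro!: sum_nonneg)

text \<open>A complex eigenvector splits into real and imaginary parts; symmetry forces the
  imaginary part of the eigenvalue to vanish.\<close>

lemma sym_mat_eigenvector_exists:
  assumes sym: "sym_mat n M" and n: "0 < n"
  shows "\<exists>e v. v \<in> carrier_vec n \<and> v \<noteq> 0\<^sub>v n \<and> M *\<^sub>v v = e \<cdot>\<^sub>v v"
proof -
  note M = sym_matD(1)[OF sym]
  define C where "C = map_mat complex_of_real M"
  have C: "C \<in> carrier_mat n n" using M by (auto simp: C_def)
  obtain z w where w: "w \<in> carrier_vec n" "w \<noteq> 0\<^sub>v n" "C *\<^sub>v w = z \<cdot>\<^sub>v w"
    using spectrum_non_empty[OF C n] C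
    by (auto simp: spectrum_def eigenvalue_def eigenvector_def)
  define a b where "a = map_vec Re w" and "b = map_vec Im w"
  have ab: "a \<in> carrier_vec n" "b \<in> carrier_vec n" using w by (auto simp: a_def b_def)
  have ent: "(\<Sum>j = 0..<n. complex_of_real (M $$ (i, j)) * vec_index w j) = z * vec_index w i"
    if i: "i < n" for i
  proof -
    have "vec_index (C *\<^sub>v w) i = (\<Sum>j = 0..<n. complex_of_real (M $$ (i, j)) * vec_index w j)"
      using i w(1) M by (auto simp: C_def scalar_prod_def intro!: sum.cong)
    then show ?thesis using w i by auto
  qed
  have Ma: "M *\<^sub>v a = Re z \<cdot>\<^sub>v a - Im z \<cdot>\<^sub>v b"
  proof (rule eq_vecI)
    fix i assume "i < dim_vec (Re z \<cdot>\<^sub>v a - Im z \<cdot>\<^sub>v b)"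
    then have i: "i < n" using ab by auto
    show "vec_index (M *\<^sub>v a) i = vec_index (Re z \<cdot>\<^sub>v a - Im z \<cdot>\<^sub>v b) i"
      using arg_cong[OF ent[OF i], of Re] i M w(1)
      by (auto simp: scalar_prod_def a_def b_def)
  qed (use M ab in auto)
  have Mb: "M *\<^sub>v b = Im z \<cdot>\<^sub>v a + Re z \<cdot>\<^sub>v b"
  proof (rule eq_vecI)
    fix i assume "i < dim_vec (Im z \<cdot>\<^sub>v a + Re z \<cdot>\<^sub>v b)"
    then have i: "i < n" using ab by auto
    show "vec_index (M *\<^sub>v b) i = vec_index (Im z \<cdot>\<^sub>v a + Re z \<cdot>\<^sub>v b) i"
      using arg_cong[OF ent[OF i], of Im] i M w(1)
      by (auto simp: scalar_prod_def a_def b_def)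
  qed (use M ab in auto)
  have nz: "a \<noteq> 0\<^sub>v n \<or> b \<noteq> 0\<^sub>v n"
  proof (rule ccontr)
    assume "\<not> ?thesis"
    then have ab0: "a = 0\<^sub>v n" "b = 0\<^sub>v n" by auto
    have "w = 0\<^sub>v n"
    proof (rule eq_vecI)
      fix i assume "i < dim_vec (0\<^sub>v n :: complex vec)"
      then show "vec_index w i = vec_index (0\<^sub>v n) i"
        using arg_cong[OF ab0(1), of "\<lambda>v. vec_index v i"] arg_cong[OF ab0(2), of "\<lambda>v. vec_index v i"] w(1)
        by (auto simp: a_def b_def complex_eq_iff)
    qed (use w in auto)
    then show False using w by simp
  qed
  \<comment> \<open>Symmetry equates the pairing of \<open>b\<close> with \<open>M a\<close> and
    that of \<open>a\<close> with \<open>M b\<close>. The terms with \<open>Re z\<close> cancel and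
    those with \<open>Im z\<close> add up.\<close>
  have "Im z * (scalar_prod a a + scalar_prod b b) = 0"
  proof -
    have "scalar_prod b (M *\<^sub>v a) = Re z * scalar_prod b a - Im z * scalar_prod b b"
      unfolding Ma using ab by (subst scalar_prod_minus_distrib[of _ n]) auto
    moreover have "scalar_prod a (M *\<^sub>v b) = Im z * scalar_prod a a + Re z * scalar_prod a b"
      unfolding Mb using ab by (subst scalar_prod_add_distrib[of _ n]) auto
    ultimately show ?thesis
      using sym_mat_scalar_prod[OF sym ab] comm_scalar_prod[OF ab] by (simp add: algebra_simps)
  qed
  moreover have "scalar_prod a a + scalar_prod b b \<noteq> 0"
    using nz ab scalar_prod_self_nonneg[of a] scalar_prod_self_nonneg[of b]
      scalar_prod_self_eq_0[OF ab(1)] scalar_prod_self_eq_0[OF ab(2)] by (smt (verit))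
  ultimately have "Im z = 0" by simp
  then have "M *\<^sub>v a = Re z \<cdot>\<^sub>v a" "M *\<^sub>v b = Re z \<cdot>\<^sub>v b"
    unfolding Ma Mb using ab by (auto intro!: eq_vecI)
  then show ?thesis using nz ab by blast
qed

lemma sym_mat_unit_eigenvector_exists:
  assumes sym: "sym_mat n M" and n: "0 < n"
  shows "\<exists>e v. v \<in> carrier_vec n \<and> scalar_prod v v = 1 \<and> M *\<^sub>v v = e \<cdot>\<^sub>v v"
proof -
  note M = sym_matD(1)[OF sym]
  obtain e v where v: "v \<in> carrier_vec n" "v \<noteq> 0\<^sub>v n" "M *\<^sub>v v = e \<cdot>\<^sub>v v"
    using sym_mat_eigenvector_exists[OF assms] by blast
  define c where "c = 1 / sqrt (scalar_prod v v)"
  have pos: "0 < scalar_prod v v"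
    using scalar_prod_self_eq_0[OF v(1)] scalar_prod_self_nonneg[of v] v(2) by force
  have "c * (c * scalar_prod v v) = 1"
    using pos by (simp add: c_def)
  then have "scalar_prod (c \<cdot>\<^sub>v v) (c \<cdot>\<^sub>v v) = 1"
    using v(1) by simp
  moreover have "M *\<^sub>v (c \<cdot>\<^sub>v v) = e \<cdot>\<^sub>v (c \<cdot>\<^sub>v v)"
    using M v by (subst mult_mat_vec[of _ n n]) (auto simp: smult_smult_assoc mult.commute)
  ultimately show ?thesis using v(1) by (intro exI[of _ e] exI[of _ "c \<cdot>\<^sub>v v"]) auto
qed

text \<open>The Householder reflection in the hyperplane orthogonal to \<open>u - e_0\<close>.  For \<open>u = e_0\<close> the
  denominator vanishes and division by zero makes it the identity.\<close>

lemma householder_exists: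
  fixes u :: "real vec"
  assumes u: "u \<in> carrier_vec n" "scalar_prod u u = 1" and n: "0 < n"
  shows "\<exists>H. sym_mat n H \<and> H * H = 1\<^sub>m n \<and> col H 0 = u"
proof -
  define w where "w i = vec_index u i - (if i = 0 then 1 else 0)" for i
  define s where "s = (\<Sum>i<n. w i * w i)"
  define H where "H = mat n n (\<lambda>(i, j). (if i = j then 1 else 0) - 2 * w i * w j / s)"
  have H: "H \<in> carrier_mat n n" by (simp add: H_def)
  have uu: "(\<Sum>i<n. vec_index u i * vec_index u i) = 1"
    using u by (auto simp: scalar_prod_def lessThan_atLeast0)
  have "s = (\<Sum>i<n. vec_index u i * vec_index u i - 2 * (if i = 0 then vec_index u i else 0)
     + (if i = 0 then 1 else 0))"
    unfolding s_def w_def by (intro sum.cong) (auto simp: algebra_simps)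
  also have "\<dots> = 1 - 2 * vec_index u 0 + 1"
    using n unfolding sum.distrib sum_subtractf sum_distrib_left[symmetric] uu
    by (simp add: sum.delta)
  \<comment> \<open>This is where \<open>u\<close> having length 1 matters: if \<open>s\<close> is
    nonzero, then \<open>- 2 * w 0 / s = 1\<close>, so the reflection sends the first unit vector to
    itself plus \<open>w\<close>, which is \<open>u\<close>.\<close>
  finally have s: "s = - 2 * w 0" by (simp add: w_def)
  have w0: "w i = 0" if "s = 0" "i < n" for i
    using that unfolding s_def by (subst (asm) sum_nonneg_eq_0_iff) auto
  have "sym_mat n H" by (rule sym_matI[OF H]) (auto simp: H_def)
  moreover have "H * H = 1\<^sub>m n"
  proof (rule eq_matI)
    fix i j assume "i < dim_row (1\<^sub>m n :: real mat)" "j < dim_col (1\<^sub>m n :: real mat)"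
    then have ij: "i < n" "j < n" by auto
    have "(H * H) $$ (i, j) = (\<Sum>k<n. ((if i = k then 1 else 0) - 2 * w i * w k / s)
        * ((if k = j then 1 else 0) - 2 * w k * w j / s))"
      using ij by (auto simp: H_def scalar_prod_def lessThan_atLeast0 intro!: sum.cong)
    also have "\<dots> = (\<Sum>k<n. (if k = i then (if i = j then 1 else 0) else 0)
        - (if k = i then 2 * w k * w j / s else 0) - (if k = j then 2 * w i * w k / s else 0)
        + (4 * w i * w j / (s * s)) * (w k * w k))"
      by (intro sum.cong) (auto simp: algebra_simps)
    also have "\<dots> = (if i = j then 1 else 0) - 2 * w i * w j / s - 2 * w i * w j / s
        + (4 * w i * w j / (s * s)) * s"
      using ij unfolding sum.distrib sum_subtractf sum_distrib_left[symmetric] s_def[symmetric]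
      by (simp add: sum.delta)
    also have "\<dots> = (if i = j then 1 else 0)"
      by (cases "s = 0") auto
    finally show "(H * H) $$ (i, j) = 1\<^sub>m n $$ (i, j)" using ij by simp
  qed (use H in auto)
  moreover have "col H 0 = u"
  proof (rule eq_vecI)
    fix i assume "i < dim_vec u"
    then have i: "i < n" using u by auto
    have "2 * w i * w 0 / s = - w i"
      using s w0[OF _ i] by (cases "s = 0") (auto simp: field_simps)
    then have "vec_index (col H 0) i = (if i = 0 then 1 else 0) + w i"
      using i n by (simp add: H_def)
    then show "vec_index (col H 0) i = vec_index u i" by (simp add: w_def)
  qed (use H u in auto)
  ultimately show ?thesis by blast
qed

text \<open>Deflation: a reflection \<open>H\<close> whose first column is a unit eigenvector is its
  own inverse and transpose, so \<open>H * M * H\<close> is symmetric with first column a multiple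
  of the first unit vector. Symmetry clears the first row as well, and the induction hypothesis
  diagonalizes the remaining block.\<close>

lemma real_spectral_theorem:
  assumes "sym_mat n M"
  shows "\<exists>U d. U \<in> carrier_mat n n \<and> U * transpose_mat U = 1\<^sub>m n
    \<and> M = U * mat_diag n d * transpose_mat U"
  using assms
proof (induction n arbitrary: M)
  case 0
  then show ?case
    by (intro exI[of _ "1\<^sub>m 0"] exI[of _ "\<lambda>_. 0"]) (auto simp: sym_mat_def intro!: eq_matI)
next
  case (Suc n)
  note M = sym_matD[OF Suc.prems]
  obtain e u where u: "u \<in> carrier_vec (Suc n)" "scalar_prod u u = 1" "M *\<^sub>v u = e \<cdot>\<^sub>v u"
    using sym_mat_unit_eigenvector_exists[OF Suc.prems] by auto
  obtain H where H: "sym_mat (Suc n) H" "H * H = 1\<^sub>m (Suc n)" "col H 0 = u"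
    using householder_exists[OF u(1,2)] by auto
  note Hc = sym_matD[OF H(1)]
  define K where "K = H * M * H"
  have K: "K \<in> carrier_mat (Suc n) (Suc n)" using Hc M by (auto simp: K_def)
  have KT: "transpose_mat K = K"
    unfolding K_def using Hc M by (simp add: transpose_mult[of _ "Suc n" "Suc n" _ "Suc n"] assoc_mult_mat[of _ "Suc n" "Suc n" _ "Suc n" _ "Suc n"])
  have symK: "sym_mat (Suc n) K" using K KT by (simp add: sym_mat_def)
  have colK: "col K 0 = e \<cdot>\<^sub>v unit_vec (Suc n) 0"
  proof -
    have "col K 0 = (H * M) *\<^sub>v u" unfolding K_def H(3)[symmetric] using Hc M
      by (subst col_mult2[of _ "Suc n" "Suc n" _ "Suc n"]) auto
    also have "\<dots> = H *\<^sub>v (e \<cdot>\<^sub>v u)" using Hc M u by (simp add: assoc_mult_mat_vec[of _ "Suc n" "Suc n"])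
    also have "\<dots> = e \<cdot>\<^sub>v (H *\<^sub>v u)" using Hc u by (subst mult_mat_vec) auto
    also have "H *\<^sub>v u = col (H * H) 0" unfolding H(3)[symmetric] using Hc
      by (subst col_mult2[of _ "Suc n" "Suc n" _ "Suc n"]) auto
    finally show ?thesis unfolding H(2) by simp
  qed
  have K0: "K $$ (i, 0) = (if i = 0 then e else 0)" "K $$ (0, i) = (if i = 0 then e else 0)"
    if "i < Suc n" for i
  proof -
    show "K $$ (i, 0) = (if i = 0 then e else 0)"
      using arg_cong[OF colK, of "\<lambda>v. vec_index v i"] that K by auto
    then show "K $$ (0, i) = (if i = 0 then e else 0)"
      using sym_mat_index[OF symK that, of 0] by simp
  qed
  define M' where "M' = mat n n (\<lambda>(i, j). K $$ (Suc i, Suc j))"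
  have "sym_mat n M'"
    by (rule sym_matI) (auto simp: M'_def intro: sym_mat_index[OF symK])
  from Suc.IH[OF this] obtain U d where U: "U \<in> carrier_mat n n" "U * transpose_mat U = 1\<^sub>m n"
    "M' = U * mat_diag n d * transpose_mat U" by blast
  define V where "V = four_block_mat (1\<^sub>m 1) (0\<^sub>m 1 n) (0\<^sub>m n 1) U"
  \<comment> \<open>The new eigenvalue takes position 0 and the old ones move up by one, matching
    the block order of \<open>V\<close>.\<close>
  define f where "f = case_nat e d"
  have V: "V \<in> carrier_mat (Suc n) (Suc n)" using U by (auto simp: V_def)
  have VT: "transpose_mat V = four_block_mat (1\<^sub>m 1) (0\<^sub>m 1 n) (0\<^sub>m n 1) (transpose_mat U)"
    unfolding V_def using U by (subst transpose_four_block_mat[of _ 1 1 _ n _ n]) auto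
  have VV: "V * transpose_mat V = 1\<^sub>m (Suc n)"
    unfolding VT unfolding V_def using U
    by (subst mult_four_block_mat[of _ 1 1 _ n _ n _ _ 1 _ n]) auto
  have D: "mat_diag (Suc n) f
      = four_block_mat (mat 1 1 (\<lambda>_. e)) (0\<^sub>m 1 n) (0\<^sub>m n 1) (mat_diag n d)"
    by (rule eq_matI) (auto simp: mat_diag_def f_def split: nat.split)
  have UD: "U * mat_diag n d \<in> carrier_mat n n"
    using U(1) by (rule mult_carrier_mat) simp
  then have UDU: "U * mat_diag n d * transpose_mat U \<in> carrier_mat n n"
    using U(1) by (intro mult_carrier_mat[OF UD]) simp
  have KV: "K = V * mat_diag (Suc n) f * transpose_mat V"
  proof -
    have "V * mat_diag (Suc n) f
        = four_block_mat (mat 1 1 (\<lambda>_. e)) (0\<^sub>m 1 n) (0\<^sub>m n 1) (U * mat_diag n d)"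
      unfolding D V_def using U left_mult_zero_mat[OF mat_diag_dim[of n d], of 1]
      by (subst mult_four_block_mat[of _ 1 1 _ n _ n _ _ 1 _ n]) auto
    also have "\<dots> * transpose_mat V = four_block_mat (mat 1 1 (\<lambda>_. e)) (0\<^sub>m 1 n) (0\<^sub>m n 1) M'"
      unfolding VT U(3)
      using U UD right_mult_zero_mat[OF UD, of 1] left_add_zero_mat[OF UDU]
      by (subst mult_four_block_mat[of _ 1 1 _ n _ n _ _ 1 _ n]) auto
    also have "\<dots> = K"
      using K K0 by (intro eq_matI) (auto simp: M'_def)
    finally show ?thesis by simp
  qed
  have HVc: "H * V \<in> carrier_mat (Suc n) (Suc n)" using Hc V by auto
  have HVT: "transpose_mat (H * V) = transpose_mat V * H"
    using Hc V by (simp add: transpose_mult[of _ "Suc n" "Suc n" _ "Suc n"])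
  note asc = assoc_mult_mat[of _ "Suc n" "Suc n" _ "Suc n" _ "Suc n"]
  have DV: "mat_diag (Suc n) f \<in> carrier_mat (Suc n) (Suc n)" by simp
  have VTc: "transpose_mat V \<in> carrier_mat (Suc n) (Suc n)" using V by simp
  have "(H * V) * transpose_mat (H * V) = H * (V * transpose_mat V) * H"
    unfolding HVT using Hc V by (simp add: asc)
  then have "(H * V) * transpose_mat (H * V) = 1\<^sub>m (Suc n)" using VV H Hc by simp
  moreover have "(H * V) * mat_diag (Suc n) f * transpose_mat (H * V) = M"
  proof -
    have "(H * V) * mat_diag (Suc n) f * transpose_mat (H * V) = H * K * H"
      unfolding HVT KV using Hc(1) V DV VTc mult_carrier_mat[OF DV VTc] mult_carrier_mat[OF VTc Hc(1)]
        mult_carrier_mat[OF DV mult_carrier_mat[OF VTc Hc(1)]]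
      by (simp add: asc)
    also have "\<dots> = (H * H) * M * (H * H)"
      unfolding K_def using Hc M by (simp add: asc)
    finally show ?thesis unfolding H(2) using M by simp
  qed
  ultimately show ?case using HVc by metis
qed

lemma mult_mat_diag_mult_index:
  fixes U :: "real mat"
  assumes U: "U \<in> carrier_mat n n" and ij: "i < n" "j < n"
  shows "(U * mat_diag n d * transpose_mat U) $$ (i, j) = (\<Sum>l<n. d l * (U $$ (i, l) * U $$ (j, l)))"
  using assms unfolding mat_diag_mult_right[OF U]
  by (auto simp: scalar_prod_def lessThan_atLeast0 intro!: sum.cong)

text \<open>The decomposition in coordinates, \<open>u l\<close> being the \<open>l\<close>-th
  column of \<open>U\<close>. The sums run over the eigenvector index \<open>l\<close>, so the
  second fact is \<open>U U^T = 1\<close> read as a resolution of the identity, which is the form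
  needed for splitting quadratic forms.\<close>

lemma spectral_expansion:
  assumes sym: "sym_mat n M"
  obtains d u where "\<And>l. l < n \<Longrightarrow> d l \<in> spectrum M"
    and "\<And>i j. i < n \<Longrightarrow> j < n \<Longrightarrow> (\<Sum>l<n. u l i * u l j) = (if i = j then 1 else 0 :: real)"
    and "\<And>i j. i < n \<Longrightarrow> j < n \<Longrightarrow> (\<Sum>l<n. d l * (u l i * u l j)) = M $$ (i, j)"
    and "char_poly (- M) = (\<Prod>l<n. [:d l, 1:])"
proof -
  obtain U d where U: "U \<in> carrier_mat n n" "U * transpose_mat U = 1\<^sub>m n"
    and M: "M = U * mat_diag n d * transpose_mat U"
    using real_spectral_theorem[OF sym] by blast
  have UT: "transpose_mat U \<in> carrier_mat n n" using U by simp
  have UTU: "transpose_mat U * U = 1\<^sub>m n"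
    using mat_mult_left_right_inverse[OF U(1) UT U(2)] .
  show ?thesis
  proof
    fix l assume l: "l < n"
    have UD: "U * mat_diag n d \<in> carrier_mat n n"
      using U(1) by (rule mult_carrier_mat) simp
    have "M * U = U * mat_diag n d"
      unfolding M assoc_mult_mat[OF UD UT U(1)] UTU by (rule right_mult_one_mat[OF UD])
    then have "M *\<^sub>v col U l = col (U * mat_diag n d) l"
      using U(1) l sym_matD(1)[OF sym] by (subst col_mult2[symmetric, of _ n n _ n]) auto
    also have "\<dots> = d l \<cdot>\<^sub>v col U l"
      unfolding mat_diag_mult_right[OF U(1)] using U(1) l by (auto intro!: eq_vecI)
    finally have ev: "M *\<^sub>v col U l = d l \<cdot>\<^sub>v col U l" .
    have "scalar_prod (col U l) (col U l) = (transpose_mat U * U) $$ (l, l)"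
      using U(1) l by simp
    then have "scalar_prod (col U l) (col U l) = 1" using UTU l by simp
    then have "col U l \<noteq> 0\<^sub>v n" by auto
    then show "d l \<in> spectrum M"
      using ev U(1) sym_matD(1)[OF sym] l
      by (auto simp: spectrum_def eigenvalue_def eigenvector_def intro!: exI[of _ "col U l"])
  next
    fix i j assume ij: "i < n" "j < n"
    have "(\<Sum>l<n. U $$ (i, l) * U $$ (j, l)) = (U * transpose_mat U) $$ (i, j)"
      using U(1) ij by (auto simp: scalar_prod_def lessThan_atLeast0 intro!: sum.cong)
    then show "(\<Sum>l<n. U $$ (i, l) * U $$ (j, l)) = (if i = j then 1 else 0)"
      using U(2) ij by simp
    show "(\<Sum>l<n. d l * (U $$ (i, l) * U $$ (j, l))) = M $$ (i, j)"
      using mult_mat_diag_mult_index[OF U(1) ij] M by simp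
  next
    \<comment> \<open>Negating \<open>M\<close> turns the factors of the characteristic polynomial
      into \<open>X + d l\<close>, so that nonnegative eigenvalues give nonnegative
      coefficients.\<close>
    let ?D = "mat_diag n (\<lambda>l. - d l)"
    have "- M = U * ?D * transpose_mat U"
      using mult_mat_diag_mult_index[OF U(1)] U(1) sym_matD(1)[OF sym]
      by (intro eq_matI) (auto simp: M sum_negf)
    then have "similar_mat_wit (- M) ?D U (transpose_mat U)"
      unfolding similar_mat_wit_def Let_def using U UT UTU sym_matD(1)[OF sym] by auto
    then have "similar_mat (- M) ?D" unfolding similar_mat_def by blast
    then have "char_poly (- M) = char_poly ?D" by (rule char_poly_similar)
    also have "\<dots> = (\<Prod>a \<leftarrow> diag_mat ?D. [:- a, 1:])"
      by (rule char_poly_upper_triangular[of _ n]) (auto simp: mat_diag_def)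
    also have "\<dots> = (\<Prod>l<n. [:d l, 1:])"
      by (simp add: diag_mat_def mat_diag_def lessThan_atLeast0 prod.list_conv_set_nth)
    finally show "char_poly (- M) = (\<Prod>l<n. [:d l, 1:])" .
  qed
qed

section \<open>Kronecker pencils\<close>

text \<open>Coefficients and coordinates are plain functions, so that sums can be split and
  reindexed without carrier conditions.\<close>

definition quad_form :: "nat \<Rightarrow> (nat \<Rightarrow> nat \<Rightarrow> real) \<Rightarrow> (nat \<Rightarrow> real) \<Rightarrow> real" where
  "quad_form n M v = (\<Sum>i<n. \<Sum>j<n. M i j * (v i * v j))"

lemma scalar_prod_mult_mat_vec:
  fixes M :: "real mat"
  assumes "M \<in> carrier_mat n n" "v \<in> carrier_vec n"
  shows "scalar_prod v (M *\<^sub>v v) = quad_form n (\<lambda>i j. M $$ (i, j)) (vec_index v)"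
  using assms unfolding quad_form_def
  by (auto simp: scalar_prod_def lessThan_atLeast0 sum_distrib_left mult_ac intro!: sum.cong)

lemma quad_form_cong:
  assumes "\<And>i j. i < n \<Longrightarrow> j < n \<Longrightarrow> M i j = M' i j" "\<And>i. i < n \<Longrightarrow> v i = v' i"
  shows "quad_form n M v = quad_form n M' v'"
  using assms unfolding quad_form_def by (intro sum.cong) auto

lemma psd_iff_quad_form:
  assumes "M \<in> carrier_mat n n"
  shows "psd M \<longleftrightarrow> sym_mat n M \<and> (\<forall>v. 0 \<le> quad_form n (\<lambda>i j. M $$ (i, j)) v)"
proof -
  have "(\<forall>v\<in>carrier_vec n. 0 \<le> scalar_prod v (M *\<^sub>v v)) \<longleftrightarrow> (\<forall>v. 0 \<le> quad_form n (\<lambda>i j. M $$ (i, j)) v)"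
  proof safe
    fix v assume A: "\<forall>v\<in>carrier_vec n. 0 \<le> scalar_prod v (M *\<^sub>v v)"
    have "0 \<le> scalar_prod (vec n v) (M *\<^sub>v vec n v)" using A by simp
    also have "\<dots> = quad_form n (\<lambda>i j. M $$ (i, j)) v"
      using assms by (subst scalar_prod_mult_mat_vec) (auto intro: quad_form_cong)
    finally show "0 \<le> quad_form n (\<lambda>i j. M $$ (i, j)) v" .
  qed (use assms scalar_prod_mult_mat_vec in auto)
  then show ?thesis using assms by (auto simp: psd_def)
qed

lemma quad_form_linear:
  "quad_form n (\<lambda>i j. a * M i j + b * M' i j) v = a * quad_form n M v + b * quad_form n M' v"
  unfolding quad_form_def by (simp add: sum_distrib_left sum.distrib algebra_simps)

lemma sum_lessThan_mult:
  fixes f :: "nat \<Rightarrow> 'a :: comm_monoid_add"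
  shows "(\<Sum>p<n * k. f p) = (\<Sum>i<n. \<Sum>a<k. f (i * k + a))"
proof -
  have "(\<Sum>p<n * k. f p) = (\<Sum>i<n. sum f {i * k..<i * k + k})"
    by (rule sum.nat_group[symmetric])
  also have "\<dots> = (\<Sum>i<n. \<Sum>a<k. f (i * k + a))"
  proof (rule sum.cong[OF refl])
    fix i
    show "sum f {i * k..<i * k + k} = (\<Sum>a<k. f (i * k + a))"
      by (rule sum.reindex_bij_witness[of _ "\<lambda>a. i * k + a" "\<lambda>p. p - i * k"]) auto
  qed
  finally show ?thesis .
qed

section \<open>Entries and symmetry of Kronecker products\<close>

lemma kron_carrier [intro, simp]:
  "F \<in> carrier_mat r c \<Longrightarrow> G \<in> carrier_mat r' c' \<Longrightarrow> kron F G \<in> carrier_mat (r * r') (c * c')"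
  by (auto simp: kron_def)

lemma mult_add_less: "i < n \<Longrightarrow> a < k \<Longrightarrow> i * k + a < n * (k :: nat)"
proof -
  assume "i < n" "a < k"
  then have "i * k + a < Suc i * k" by simp
  also have "\<dots> \<le> n * k" using \<open>i < n\<close> by (intro mult_right_mono) auto
  finally show ?thesis .
qed

lemma kron_index:
  assumes "F \<in> carrier_mat n n'" "G \<in> carrier_mat k k'" "i < n" "j < n'" "a < k" "b < k'"
  shows "kron F G $$ (i * k + a, j * k' + b) = F $$ (i, j) * G $$ (a, b)"
  using assms by (auto simp: kron_def mult_add_less div_mult_self3)

lemma div_mod_less:
  assumes "p < n * (k :: nat)"
  shows "p div k < n" "p mod k < k"
  using assms by (auto simp: less_mult_imp_div_less) (metis mod_less_divisor mult_0_right not_gr_zero not_less_zero)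

lemma kron_index':
  assumes "F \<in> carrier_mat n n'" "G \<in> carrier_mat k k'" "p < n * k" "q < n' * k'"
  shows "kron F G $$ (p, q) = F $$ (p div k, q div k') * G $$ (p mod k, q mod k')"
  using assms by (auto simp: kron_def)

lemma sym_mat_kron:
  assumes "sym_mat n F" "sym_mat k G"
  shows "sym_mat (n * k) (kron F G)"
proof (rule sym_matI)
  fix p q assume pq: "p < n * k" "q < n * k"
  note pq' = div_mod_less[OF pq(1)] div_mod_less[OF pq(2)]
  show "kron F G $$ (p, q) = kron F G $$ (q, p)"
    using sym_mat_index[OF assms(1) pq'(1,3)] sym_mat_index[OF assms(2) pq'(2,4)] pq
      sym_matD(1)[OF assms(1)] sym_matD(1)[OF assms(2)]
    by (simp add: kron_index'[of _ n n _ k k])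
qed (use assms in \<open>auto dest: sym_matD\<close>)

lemma sym_mat_add: "sym_mat n F \<Longrightarrow> sym_mat n G \<Longrightarrow> sym_mat n (F + G)"
  unfolding sym_mat_def by (metis add_carrier_mat transpose_add)

lemma sym_mat_smult: "sym_mat n F \<Longrightarrow> sym_mat n (c \<cdot>\<^sub>m F)"
  by (rule sym_matI) (auto dest: sym_matD simp: sym_mat_index[of n F] sym_mat_def)

lemma sym_mat_one: "sym_mat n (1\<^sub>m n)"
  by (simp add: sym_mat_def)

lemma sym_mat_mat_sum:
  assumes "\<And>k. k \<in> I \<Longrightarrow> sym_mat n (F k)"
  shows "sym_mat n (mat_sum n F I)"
  by (rule sym_matI) (auto simp: mat_sum_def sym_mat_index[OF assms] intro!: sum.cong)

text \<open>An index of the large matrix is written \<open>i * k + a\<close>, with \<open>i\<close>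
  the index into the left tensor factor and \<open>a\<close> the index into the right one.\<close>

lemma quad_form_kron_pencil:
  assumes F: "F \<in> carrier_mat k k" and A: "A \<in> carrier_mat k k" and B: "B \<in> carrier_mat n n"
  shows "quad_form (n * k) (\<lambda>p q. (kron (1\<^sub>m n) F + kron B A) $$ (p, q)) v
    = (\<Sum>i<n. \<Sum>a<k. \<Sum>j<n. \<Sum>b<k. ((if i = j then F $$ (a, b) else 0) + B $$ (i, j) * A $$ (a, b))
        * (v (i * k + a) * v (j * k + b)))"
proof -
  have "(kron (1\<^sub>m n) F + kron B A) $$ (i * k + a, j * k + b)
      = (if i = j then F $$ (a, b) else 0) + B $$ (i, j) * A $$ (a, b)"
    if "i < n" "j < n" "a < k" "b < k" for i j a b
  proof -
    have dim: "dim_row (kron B A) = n * k" "dim_col (kron B A) = n * k"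
      using kron_carrier[OF B A] by auto
    show ?thesis
      using dim that mult_add_less[OF that(1,3)] mult_add_less[OF that(2,4)]
        kron_index[OF one_carrier_mat F that] kron_index[OF B A that] by simp
  qed
  then show ?thesis
    unfolding quad_form_def sum_lessThan_mult by (intro sum.cong refl) auto
qed

text \<open>With \<open>1 = \<Sum>\<^sub>l u\<^sub>l u\<^sub>l\<^sup>T\<close> and \<open>B = \<Sum>\<^sub>l d\<^sub>l u\<^sub>l u\<^sub>l\<^sup>T\<close>, the form of \<open>1 \<otimes> F + B \<otimes> A\<close> splits into
  the forms of \<open>F + d\<^sub>l A\<close>.\<close>

lemma psd_kron_pencil_iff:
  assumes n: "0 < n" and B: "sym_mat n B" and F: "sym_mat k F" and A: "sym_mat k A"
  shows "psd (kron (1\<^sub>m n) F + kron B A)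
    \<longleftrightarrow> (\<forall>t. lambda_min B \<le> t \<and> t \<le> lambda_max B \<longrightarrow> psd (F + t \<cdot>\<^sub>m A))"
proof -
  note c = sym_matD(1)[OF F] sym_matD(1)[OF A] sym_matD(1)[OF B]
  \<comment> \<open>The form of \<open>F + t A\<close> at \<open>w\<close>, written so that its
    affine dependence on \<open>t\<close> is visible.\<close>
  define Q where "Q t w = quad_form k (\<lambda>a b. F $$ (a, b)) w + t * quad_form k (\<lambda>a b. A $$ (a, b)) w" for t w
  have sym: "sym_mat (n * k) (kron (1\<^sub>m n) F + kron B A)"
    using assms by (intro sym_mat_add sym_mat_kron sym_mat_one)
  have psdt: "psd (F + t \<cdot>\<^sub>m A) \<longleftrightarrow> (\<forall>w. 0 \<le> Q t w)" for t
  proof -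
    have "quad_form k (\<lambda>a b. (F + t \<cdot>\<^sub>m A) $$ (a, b)) w = Q t w" for w
      unfolding Q_def quad_form_linear[of k 1 _ t, simplified, symmetric]
      using c by (intro quad_form_cong) auto
    moreover have "sym_mat k (F + t \<cdot>\<^sub>m A)" using F A by (intro sym_mat_add sym_mat_smult)
    ultimately show ?thesis using psd_iff_quad_form[of _ k] sym_matD(1) by simp
  qed
  have Qeq: "Q t w = (\<Sum>a<k. \<Sum>b<k. (F $$ (a, b) + t * A $$ (a, b)) * (w a * w b))" for t w
    unfolding Q_def quad_form_linear[of k 1 _ t, simplified, symmetric]
    by (simp add: quad_form_def)
  let ?q = "quad_form (n * k) (\<lambda>p q. (kron (1\<^sub>m n) F + kron B A) $$ (p, q))"
  obtain d u where d: "\<And>l. l < n \<Longrightarrow> d l \<in> spectrum B"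
    and u: "\<And>i j. i < n \<Longrightarrow> j < n \<Longrightarrow> (\<Sum>l<n. u l i * u l j) = (if i = j then 1 else 0 :: real)"
    and du: "\<And>i j. i < n \<Longrightarrow> j < n \<Longrightarrow> (\<Sum>l<n. d l * (u l i * u l j)) = B $$ (i, j)"
    by (rule spectral_expansion[OF B], rule that)
  have fin: "finite (spectrum B)" and ne: "spectrum B \<noteq> {}"
    using card_finite_spectrum[OF c(3)] d[OF n] by auto
  have split: "?q v = (\<Sum>l<n. Q (d l) (\<lambda>a. \<Sum>i<n. u l i * v (i * k + a)))" for v
  proof -
    have "(\<Sum>l<n. Q (d l) (\<lambda>a. \<Sum>i<n. u l i * v (i * k + a)))
       = (\<Sum>l<n. \<Sum>a<k. \<Sum>b<k. \<Sum>i<n. \<Sum>j<n. (F $$ (a, b) + d l * A $$ (a, b))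
          * (u l i * v (i * k + a) * (u l j * v (j * k + b))))"
      unfolding Qeq sum_product unfolding sum_distrib_left ..
    \<comment> \<open>With \<open>l\<close> innermost, the sum over eigenvectors can be collapsed by
      \<open>u\<close> to the identity and by \<open>du\<close> to \<open>B\<close>.\<close>
    also have "\<dots> = (\<Sum>a<k. \<Sum>b<k. \<Sum>i<n. \<Sum>j<n. \<Sum>l<n. (F $$ (a, b) + d l * A $$ (a, b))
          * (u l i * v (i * k + a) * (u l j * v (j * k + b))))"
      by (rule trans[OF sum.swap], rule sum.cong[OF refl], rule trans[OF sum.swap],
          rule sum.cong[OF refl], rule trans[OF sum.swap], rule sum.cong[OF refl], rule sum.swap)
    also have "\<dots> = (\<Sum>a<k. \<Sum>b<k. \<Sum>i<n. \<Sum>j<n. ((if i = j then F $$ (a, b) else 0) + B $$ (i, j) * A $$ (a, b))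
        * (v (i * k + a) * v (j * k + b)))"
    proof (intro sum.cong refl)
      fix a b i j assume ij: "i \<in> {..<n}" "j \<in> {..<n}"
      have "(\<Sum>l<n. (F $$ (a, b) + d l * A $$ (a, b)) * (u l i * v (i * k + a) * (u l j * v (j * k + b))))
        = (F $$ (a, b) * (\<Sum>l<n. u l i * u l j) + (\<Sum>l<n. d l * (u l i * u l j)) * A $$ (a, b))
          * (v (i * k + a) * v (j * k + b))"
        unfolding sum_distrib_left sum_distrib_right sum.distrib[symmetric]
        by (intro sum.cong refl) (simp add: algebra_simps)
      then show "(\<Sum>l<n. (F $$ (a, b) + d l * A $$ (a, b)) * (u l i * v (i * k + a) * (u l j * v (j * k + b))))
        = ((if i = j then F $$ (a, b) else 0) + B $$ (i, j) * A $$ (a, b)) * (v (i * k + a) * v (j * k + b))"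
        using u du ij by auto
    qed
    also have "\<dots> = ?q v"
      unfolding quad_form_kron_pencil[OF c]
      by (simp only: sum.swap[of _ "{..<k}" "{..<n}"])
    finally show ?thesis by simp
  qed
  have psdL: "psd (kron (1\<^sub>m n) F + kron B A) \<longleftrightarrow> (\<forall>v. 0 \<le> ?q v)"
    using psd_iff_quad_form[OF sym_matD(1)[OF sym]] sym by simp
  show ?thesis
  proof
    assume "psd (kron (1\<^sub>m n) F + kron B A)"
    then have q: "0 \<le> ?q v" for v using psdL by blast
    \<comment> \<open>An arbitrary eigenvalue is treated, not just the \<open>d l\<close>: the
      extreme eigenvalues are known as members of the spectrum, whereas the expansion does not state
      that every eigenvalue is some \<open>d l\<close>.\<close>
    have ev: "0 \<le> Q e w" if e: "e \<in> spectrum B" for e w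
    proof -
      obtain x where x: "x \<in> carrier_vec n" "x \<noteq> 0\<^sub>v n" "B *\<^sub>v x = e \<cdot>\<^sub>v x"
        using e c by (auto simp: spectrum_def eigenvalue_def eigenvector_def)
      define r where "r = (\<Sum>i<n. vec_index x i * vec_index x i)"
      have "r = scalar_prod x x" using x(1) by (auto simp: r_def scalar_prod_def lessThan_atLeast0)
      then have r: "0 < r"
        using scalar_prod_self_eq_0[OF x(1)] scalar_prod_self_nonneg[of x] x(2) by linarith
      have Bx: "(\<Sum>j<n. B $$ (i, j) * vec_index x j) = e * vec_index x i" if "i < n" for i
        using arg_cong[OF x(3), of "\<lambda>v. vec_index v i"] that x(1) c
        by (simp add: scalar_prod_def lessThan_atLeast0)
      \<comment> \<open>The coordinates of the pure tensor of the eigenvector \<open>x\<close> with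
        \<open>w\<close>. On it the large form factors as \<open>Q e w\<close> times the squared
        length of \<open>x\<close>.\<close>
      let ?v = "\<lambda>p. vec_index x (p div k) * w (p mod k)"
      have "?q ?v = (\<Sum>i<n. \<Sum>a<k. \<Sum>j<n. \<Sum>b<k. ((if i = j then F $$ (a, b) else 0) + B $$ (i, j) * A $$ (a, b))
        * ((vec_index x i * w a) * (vec_index x j * w b)))"
        unfolding quad_form_kron_pencil[OF c] by (intro sum.cong refl) (auto simp: div_mult_self3)
      also have "\<dots> = (\<Sum>a<k. \<Sum>b<k. \<Sum>i<n. \<Sum>j<n. ((if i = j then F $$ (a, b) else 0) + B $$ (i, j) * A $$ (a, b))
        * ((vec_index x i * w a) * (vec_index x j * w b)))"
        by (simp only: sum.swap[of _ "{..<k}" "{..<n}"])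
      also have "\<dots> = (\<Sum>a<k. \<Sum>b<k. (F $$ (a, b) + e * A $$ (a, b)) * (w a * w b) * r)"
      proof (intro sum.cong refl)
        fix a b
        have "(\<Sum>i<n. \<Sum>j<n. ((if i = j then F $$ (a, b) else 0) + B $$ (i, j) * A $$ (a, b))
            * ((vec_index x i * w a) * (vec_index x j * w b)))
          = (\<Sum>i<n. (F $$ (a, b) * vec_index x i + A $$ (a, b) * (\<Sum>j<n. B $$ (i, j) * vec_index x j))
             * (vec_index x i * w a * w b))"
        proof (intro sum.cong refl)
          fix i assume i: "i \<in> {..<n}"
          have "(\<Sum>j<n. ((if i = j then F $$ (a, b) else 0) + B $$ (i, j) * A $$ (a, b))
            * ((vec_index x i * w a) * (vec_index x j * w b)))
            = (\<Sum>j<n. (if j = i then F $$ (a, b) * vec_index x j * (vec_index x i * w a * w b) else 0)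
              + B $$ (i, j) * vec_index x j * (A $$ (a, b) * (vec_index x i * w a * w b)))"
            by (intro sum.cong refl) (auto simp: algebra_simps)
          also have "\<dots> = (F $$ (a, b) * vec_index x i + A $$ (a, b) * (\<Sum>j<n. B $$ (i, j) * vec_index x j))
             * (vec_index x i * w a * w b)"
            using i unfolding sum.distrib sum_distrib_right[symmetric]
            by (simp add: algebra_simps)
          finally show "(\<Sum>j<n. ((if i = j then F $$ (a, b) else 0) + B $$ (i, j) * A $$ (a, b))
            * ((vec_index x i * w a) * (vec_index x j * w b))) = \<dots>" .
        qed
        also have "\<dots> = (\<Sum>i<n. (F $$ (a, b) + e * A $$ (a, b)) * (w a * w b)
            * (vec_index x i * vec_index x i))"
          by (intro sum.cong refl, simp only: lessThan_iff Bx) (simp add: algebra_simps)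
        also have "\<dots> = (F $$ (a, b) + e * A $$ (a, b)) * (w a * w b) * r"
          unfolding r_def sum_distrib_left ..
        finally show "(\<Sum>i<n. \<Sum>j<n. ((if i = j then F $$ (a, b) else 0) + B $$ (i, j) * A $$ (a, b))
            * ((vec_index x i * w a) * (vec_index x j * w b)))
          = (F $$ (a, b) + e * A $$ (a, b)) * (w a * w b) * r" .
      qed
      also have "\<dots> = Q e w * r"
        unfolding Qeq sum_distrib_right ..
      finally show ?thesis using q[of ?v] r by (simp add: zero_le_mult_iff)
    qed
    show "\<forall>t. lambda_min B \<le> t \<and> t \<le> lambda_max B \<longrightarrow> psd (F + t \<cdot>\<^sub>m A)"
    proof (intro allI impI)
      fix t assume t: "lambda_min B \<le> t \<and> t \<le> lambda_max B"
      have "0 \<le> Q t w" for w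
      proof -
        have lo: "0 \<le> Q (lambda_min B) w" and hi: "0 \<le> Q (lambda_max B) w"
          using ev Min_in[OF fin ne] Max_in[OF fin ne] by (auto simp: lambda_min_def lambda_max_def)
        define y where "y = quad_form k (\<lambda>a b. A $$ (a, b)) w"
        \<comment> \<open>The sign of the slope \<open>y\<close> decides which endpoint bounds the
          affine function from below.\<close>
        have "lambda_min B * y \<le> t * y \<or> lambda_max B * y \<le> t * y"
          using t by (cases "0 \<le> y") (auto intro: mult_right_mono mult_right_mono_neg)
        then show ?thesis using lo hi unfolding Q_def y_def by linarith
      qed
      then show "psd (F + t \<cdot>\<^sub>m A)" using psdt by blast
    qed
  next
    assume R: "\<forall>t. lambda_min B \<le> t \<and> t \<le> lambda_max B \<longrightarrow> psd (F + t \<cdot>\<^sub>m A)"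
    \<comment> \<open>Each \<open>d l\<close> lies between the extreme eigenvalues, so every summand
      in \<open>split\<close> is nonnegative.\<close>
    have "0 \<le> Q (d l) w" if "l < n" for l w
      using R psdt d[OF that] fin by (simp add: lambda_min_def lambda_max_def)
    then show "psd (kron (1\<^sub>m n) F + kron B A)"
      unfolding psdL split by (intro allI sum_nonneg) auto
  qed
qed

section \<open>Algebra of Kronecker products\<close>

lemma kron_assoc:
  assumes A: "A \<in> carrier_mat r r'" and B: "B \<in> carrier_mat s s'" and C: "C \<in> carrier_mat t t'"
  shows "kron (kron A B) C = kron A (kron B C)"
proof (rule eq_matI)
  have AB: "kron A B \<in> carrier_mat (r * s) (r' * s')" and BC: "kron B C \<in> carrier_mat (s * t) (s' * t')"
    using assms by simp_all
  fix p q assume "p < dim_row (kron A (kron B C))" "q < dim_col (kron A (kron B C))"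
  then have p: "p < r * (s * t)" and q: "q < r' * (s' * t')"
    using kron_carrier[OF A BC] by auto
  note pq = div_mod_less[OF p] div_mod_less[OF q]
  have p': "p < (r * s) * t" and q': "q < (r' * s') * t'" using p q by (simp_all add: mult.assoc)
  \<comment> \<open>An index is a three-digit number in mixed radix; these rules show that both
    bracketings read off the same digits.\<close>
  have *: "x div y div z = x div (z * y)" "x div y mod z = x mod (z * y) div y"
    "x mod y = x mod (z * y) mod y" if "0 < y" for x y z :: nat
    using that by (simp_all add: div_mult2_eq mult.commute[of z y] mod_mult2_eq)
  have t: "0 < t" "0 < t'" using p q by (auto intro: gr0I)
  show "kron (kron A B) C $$ (p, q) = kron A (kron B C) $$ (p, q)"
    using div_mod_less[OF p'] div_mod_less[OF q']
    by (simp add: kron_index'[OF AB C p' q'] kron_index'[OF A BC p q] kron_index'[OF A B]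
        kron_index'[OF B C pq(2,4)] *[OF t(1), of p s] *[OF t(2), of q s'] mult.assoc)
qed (use assms in \<open>auto simp: kron_def mult.assoc\<close>)

lemma kron_add_right:
  assumes A: "A \<in> carrier_mat r r'" and B: "B \<in> carrier_mat s s'" and C: "C \<in> carrier_mat s s'"
  shows "kron A (B + C) = kron A B + kron A C"
proof (rule eq_matI)
  have BC: "B + C \<in> carrier_mat s s'" using assms by simp
  fix p q assume "p < dim_row (kron A B + kron A C)" "q < dim_col (kron A B + kron A C)"
  then have pq: "p < r * s" "q < r' * s'"
    using kron_carrier[OF A C] by auto
  then show "kron A (B + C) $$ (p, q) = (kron A B + kron A C) $$ (p, q)"
    using div_mod_less[OF pq(1)] div_mod_less[OF pq(2)] B C kron_carrier[OF A C]
    by (simp add: kron_index'[OF A B] kron_index'[OF A BC] kron_index'[OF A C] distrib_left)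
qed (use assms in \<open>auto simp: kron_def\<close>)

lemma kron_smult_right:
  assumes "A \<in> carrier_mat r r'" "B \<in> carrier_mat s s'"
  shows "kron A (c \<cdot>\<^sub>m B) = c \<cdot>\<^sub>m kron A B"
  using assms by (intro eq_matI) (auto simp: kron_def div_mod_less)

lemma kron_smult_left:
  assumes "A \<in> carrier_mat r r'" "B \<in> carrier_mat s s'"
  shows "kron (c \<cdot>\<^sub>m A) B = c \<cdot>\<^sub>m kron A B"
  using assms by (intro eq_matI) (auto simp: kron_def div_mod_less)

lemma kron_one_one: "kron (1\<^sub>m r) (1\<^sub>m s) = 1\<^sub>m (r * s)"
proof (rule eq_matI)
  fix p q assume "p < dim_row (1\<^sub>m (r * s) :: real mat)" "q < dim_col (1\<^sub>m (r * s) :: real mat)"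
  then have pq: "p < r * s" "q < r * s" by auto
  have "p = q \<longleftrightarrow> p div s = q div s \<and> p mod s = q mod s"
    by (metis div_mult_mod_eq)
  then show "kron (1\<^sub>m r) (1\<^sub>m s) $$ (p, q) = 1\<^sub>m (r * s) $$ (p, q)"
    using pq div_mod_less[OF pq(1)] div_mod_less[OF pq(2)]
    by (auto simp: kron_index'[of _ r r _ s s])
qed (auto simp: kron_def)

lemma kron_zero_left: "G \<in> carrier_mat s s' \<Longrightarrow> kron (0\<^sub>m r r') G = 0\<^sub>m (r * s) (r' * s')"
  by (intro eq_matI) (auto simp: kron_def div_mod_less)

lemma kron_zero_right: "F \<in> carrier_mat r r' \<Longrightarrow> kron F (0\<^sub>m s s') = 0\<^sub>m (r * s) (r' * s')"
  by (intro eq_matI) (auto simp: kron_def div_mod_less)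

lemma kron_mat_sum_right:
  assumes A: "A \<in> carrier_mat r r" and F: "\<And>i. i \<in> I \<Longrightarrow> F i \<in> carrier_mat s s"
  shows "kron A (mat_sum s F I) = mat_sum (r * s) (\<lambda>i. kron A (F i)) I"
proof (rule eq_matI)
  fix p q assume "p < dim_row (mat_sum (r * s) (\<lambda>i. kron A (F i)) I)"
    "q < dim_col (mat_sum (r * s) (\<lambda>i. kron A (F i)) I)"
  then have pq: "p < r * s" "q < r * s" by (auto simp: mat_sum_def)
  have S: "mat_sum s F I \<in> carrier_mat s s" by (simp add: mat_sum_def)
  show "kron A (mat_sum s F I) $$ (p, q) = mat_sum (r * s) (\<lambda>i. kron A (F i)) I $$ (p, q)"
    unfolding kron_index'[OF A S pq] using pq div_mod_less[OF pq(1)] div_mod_less[OF pq(2)]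
    by (simp add: mat_sum_def sum_distrib_left kron_index'[OF A F pq])
qed (use A in \<open>auto simp: kron_def mat_sum_def\<close>)

lemma mat_sum_carrier [simp]: "mat_sum n F I \<in> carrier_mat n n"
  by (simp add: mat_sum_def)

lemma mat_sum_empty: "mat_sum n F {} = 0\<^sub>m n n"
  by (auto simp: mat_sum_def intro!: eq_matI)

lemma mat_sum_insert:
  assumes "finite I" "k \<notin> I" "F k \<in> carrier_mat n n"
  shows "mat_sum n F (insert k I) = F k + mat_sum n F I"
  using assms by (auto simp: mat_sum_def intro!: eq_matI)

lemma mat_sum_cong: "(\<And>i. i \<in> I \<Longrightarrow> F i = G i) \<Longrightarrow> mat_sum n F I = mat_sum n G I"
  unfolding mat_sum_def by (simp cong: sum.cong)

lemma mat_add_rotate: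
  fixes X Y Z :: "'a :: ab_semigroup_add mat"
  assumes "X \<in> carrier_mat n n" "Y \<in> carrier_mat n n" "Z \<in> carrier_mat n n"
  shows "X + (Y + Z) = (X + Z) + Y" "X + (Y + Z) = (X + Y) + Z"
  using assms by (auto intro!: eq_matI simp: ac_simps)

text \<open>The matrix \<open>1 \<otimes> G + \<Sum>\<^sub>k (1 \<otimes> B\<^sub>k \<otimes> 1) \<otimes> A\<^sub>k\<close>, built by absorbing the last tensor factor into
  the constant term: \<open>G\<close> becomes \<open>1 \<otimes> G + B\<^sub>m \<otimes> A\<^sub>m\<close> and the remaining \<open>A\<^sub>k\<close> become \<open>1 \<otimes> A\<^sub>k\<close>, so that an
  induction needs to treat only one \<open>B\<^sub>k\<close> at a time.\<close>

primrec lmi_rec :: "(nat \<Rightarrow> nat) \<Rightarrow> (nat \<Rightarrow> real mat) \<Rightarrow> nat \<Rightarrow> real mat \<Rightarrow> (nat \<Rightarrow> real mat) \<Rightarrow> real mat"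
  where
    "lmi_rec N Bx 0 G A = G"
  | "lmi_rec N Bx (Suc m) G A =
       lmi_rec N Bx m (kron (1\<^sub>m (N (Suc m))) G + kron (Bx (Suc m)) (A (Suc m)))
         (\<lambda>i. kron (1\<^sub>m (N (Suc m))) (A i))"

section \<open>Coefficients of the Kronecker sum\<close>

lemma L_form_0: "L_form 0 Bx d a = (d * a 0) \<cdot>\<^sub>m 1\<^sub>m 1"
  by (auto simp: L_form_def intro!: eq_matI)

lemma L_form_Suc:
  "L_form (Suc m) Bx d a = kron_sum (L_form m Bx d a) (a (Suc m) \<cdot>\<^sub>m Bx (Suc m))"
  by (simp add: L_form_def)

context
  fixes N :: "nat \<Rightarrow> nat" and Bx :: "nat \<Rightarrow> real mat" and d :: real and m :: nat
  assumes Bx: "\<And>k. 1 \<le> k \<Longrightarrow> k \<le> m \<Longrightarrow> Bx k \<in> carrier_mat (N k) (N k)"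
begin

lemma L_form_carrier:
  "j \<le> m \<Longrightarrow> L_form j Bx d a \<in> carrier_mat (\<Prod>k=1..j. N k) (\<Prod>k=1..j. N k)"
proof (induction j)
  case (Suc j)
  then show ?case
    using Bx[of "Suc j"] by (auto simp: L_form_Suc kron_sum_def)
qed (simp add: L_form_0)

text \<open>A summand whose unknown is set to 0 contributes only an identity factor to the Kronecker
  sum.\<close>

lemma L_form_unit_0:
  "j \<le> m \<Longrightarrow> L_form j Bx d (unit_assignment 0) = d \<cdot>\<^sub>m 1\<^sub>m (\<Prod>k=1..j. N k)"
proof (induction j)
  case (Suc j)
  have B: "0 \<cdot>\<^sub>m Bx (Suc j) = 0\<^sub>m (N (Suc j)) (N (Suc j))"
    using Bx[of "Suc j"] Suc.prems by (auto intro!: eq_matI)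
  show ?case
    using Suc by (simp add: L_form_Suc kron_sum_def unit_assignment_def B kron_smult_left[OF one_carrier_mat one_carrier_mat]
        kron_one_one kron_zero_right[of _ "\<Prod>k=Suc 0..j. N k" "\<Prod>k=Suc 0..j. N k"])
qed (simp add: L_form_0 unit_assignment_def)

text \<open>The first \<open>j\<close> summands do not involve the unknown \<open>a i\<close>. This
  makes the old part of the Kronecker sum drop out at the stage where summand \<open>i\<close> is
  added.\<close>

lemma L_form_unit_beyond:
  "j \<le> m \<Longrightarrow> j < i \<Longrightarrow> L_form j Bx d (unit_assignment i) = 0\<^sub>m (\<Prod>k=1..j. N k) (\<Prod>k=1..j. N k)"
proof (induction j)
  case 0
  then show ?case by (auto simp: L_form_0 unit_assignment_def intro!: eq_matI)
next
  case (Suc j)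
  have B: "0 \<cdot>\<^sub>m Bx (Suc j) = 0\<^sub>m (N (Suc j)) (N (Suc j))"
    using Bx[of "Suc j"] Suc.prems by (auto intro!: eq_matI)
  show ?case
    using Suc by (simp add: L_form_Suc kron_sum_def unit_assignment_def[of i] B
        kron_zero_left[of _ "N (Suc j)" "N (Suc j)"]
        kron_zero_right[of _ "\<Prod>k=Suc 0..j. N k" "\<Prod>k=Suc 0..j. N k"])
qed

lemma L_form_unit_top:
  assumes "Suc j \<le> m"
  shows "L_form (Suc j) Bx d (unit_assignment (Suc j)) = kron (1\<^sub>m (\<Prod>k=1..j. N k)) (Bx (Suc j))"
proof -
  have B: "Bx (Suc j) \<in> carrier_mat (N (Suc j)) (N (Suc j))" using Bx assms by simp
  have "1 \<cdot>\<^sub>m Bx (Suc j) = Bx (Suc j)" by (auto intro!: eq_matI)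
  then show ?thesis
    using B assms L_form_unit_beyond[of j "Suc j"] kron_carrier[OF one_carrier_mat B]
    by (simp add: L_form_Suc kron_sum_def unit_assignment_def[of "Suc j"] kron_zero_left[of _ "N (Suc j)" "N (Suc j)"])
qed

text \<open>The identity factor appended here is what associativity later hands over to
  \<open>A i\<close>, in agreement with the recursion of \<open>lmi_rec\<close>.\<close>

lemma L_form_unit_Suc:
  assumes "Suc j \<le> m" "i \<noteq> Suc j"
  shows "L_form (Suc j) Bx d (unit_assignment i)
    = kron (L_form j Bx d (unit_assignment i)) (1\<^sub>m (N (Suc j)))"
proof -
  have B: "0 \<cdot>\<^sub>m Bx (Suc j) = 0\<^sub>m (N (Suc j)) (N (Suc j))"
    using Bx[of "Suc j"] assms by (auto intro!: eq_matI)
  have L: "L_form j Bx d (unit_assignment i) \<in> carrier_mat (\<Prod>k=1..j. N k) (\<Prod>k=1..j. N k)"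
    using L_form_carrier assms by simp
  show ?thesis
    using L assms(2) kron_carrier[OF L one_carrier_mat, of "N (Suc j)"]
    by (simp add: L_form_Suc kron_sum_def unit_assignment_def[of i] B
        kron_zero_right[of _ "\<Prod>k=1..j. N k" "\<Prod>k=1..j. N k"])
qed

text \<open>The term of index 0 is kept apart as \<open>G\<close>, because absorbing a factor mixes
  it with the last coefficient. The statement has to hold for all \<open>K\<close>, \<open>G\<close>
  and \<open>A\<close>, since the induction hypothesis is applied to the absorbed data of size
  \<open>n * K\<close>.\<close>

lemma lmi_rec_eq:
  assumes "j \<le> m" "G \<in> carrier_mat K K" "\<And>i. 1 \<le> i \<Longrightarrow> i \<le> j \<Longrightarrow> A i \<in> carrier_mat K K"
  shows "kron (1\<^sub>m (\<Prod>k=1..j. N k)) G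
      + mat_sum ((\<Prod>k=1..j. N k) * K) (\<lambda>i. kron (L_form j Bx d (unit_assignment i)) (A i)) {1..j}
    = lmi_rec N Bx j G A"
  using assms
proof (induction j arbitrary: K G A)
  case 0
  have "kron (1\<^sub>m 1) G = G"
    using 0 by (intro eq_matI) (auto simp: kron_def)
  then show ?case using 0 by (simp add: mat_sum_empty)
next
  case (Suc j)
  define P where "P = (\<Prod>k=1..j. N k)"
  define n where "n = N (Suc j)"
  let ?E = "\<lambda>i. L_form j Bx d (unit_assignment i)"
  note G = Suc.prems(2)
  have B: "Bx (Suc j) \<in> carrier_mat n n" using Bx Suc.prems by (simp add: n_def)
  have A: "A i \<in> carrier_mat K K" if "1 \<le> i" "i \<le> Suc j" for i using Suc.prems that by simp
  have E: "?E i \<in> carrier_mat P P" for i using L_form_carrier Suc.prems by (simp add: P_def)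
  have Pn: "(\<Prod>k=1..Suc j. N k) = P * n" by (simp add: P_def n_def)
  have IH: "kron (1\<^sub>m P) (kron (1\<^sub>m n) G + kron (Bx (Suc j)) (A (Suc j)))
      + mat_sum (P * n * K) (\<lambda>i. kron (?E i) (kron (1\<^sub>m n) (A i))) {1..j}
    = lmi_rec N Bx (Suc j) G A"
    unfolding mult.assoc unfolding P_def lmi_rec.simps n_def[symmetric]
    using Suc.prems B A by (intro Suc.IH) auto
  have fold_top: "kron (1\<^sub>m P) (kron (1\<^sub>m n) G + kron (Bx (Suc j)) (A (Suc j)))
      = kron (1\<^sub>m (P * n)) G + kron (kron (1\<^sub>m P) (Bx (Suc j))) (A (Suc j))"
    using G B A[of "Suc j"]
    by (simp add: kron_add_right[of _ P P _ "n * K" "n * K"] kron_one_one[symmetric] kron_assoc[of _ P P _ n n _ K K])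
  have peel: "mat_sum (P * n * K) (\<lambda>i. kron (L_form (Suc j) Bx d (unit_assignment i)) (A i)) {1..Suc j}
    = kron (kron (1\<^sub>m P) (Bx (Suc j))) (A (Suc j))
      + mat_sum (P * n * K) (\<lambda>i. kron (?E i) (kron (1\<^sub>m n) (A i))) {1..j}"
  proof -
    have top: "kron (L_form (Suc j) Bx d (unit_assignment (Suc j))) (A (Suc j))
        = kron (kron (1\<^sub>m P) (Bx (Suc j))) (A (Suc j))"
      using L_form_unit_top[of j] Suc.prems by (simp add: P_def)
    have tc: "kron (kron (1\<^sub>m P) (Bx (Suc j))) (A (Suc j)) \<in> carrier_mat (P * n * K) (P * n * K)"
      using B A[of "Suc j"] by simp
    have "{1..Suc j} = insert (Suc j) {1..j}" by auto
    then have "mat_sum (P * n * K) (\<lambda>i. kron (L_form (Suc j) Bx d (unit_assignment i)) (A i)) {1..Suc j}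
      = kron (kron (1\<^sub>m P) (Bx (Suc j))) (A (Suc j))
        + mat_sum (P * n * K) (\<lambda>i. kron (L_form (Suc j) Bx d (unit_assignment i)) (A i)) {1..j}"
      using tc by (simp only:) (subst mat_sum_insert, auto simp: top)
    \<comment> \<open>For \<open>i\<close> up to \<open>j\<close> the factor
      \<open>1\<^sub>m n\<close> passes from the left tensor factor to \<open>A i\<close>; only the
      top term carries \<open>Bx (Suc j)\<close>.\<close>
    moreover have "kron (L_form (Suc j) Bx d (unit_assignment i)) (A i) = kron (?E i) (kron (1\<^sub>m n) (A i))"
      if "i \<in> {1..j}" for i
      using that Suc.prems L_form_unit_Suc[of j i] kron_assoc[OF E one_carrier_mat A[of i], of i n]
      by (simp add: n_def)
    then have "mat_sum (P * n * K) (\<lambda>i. kron (L_form (Suc j) Bx d (unit_assignment i)) (A i)) {1..j}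
      = mat_sum (P * n * K) (\<lambda>i. kron (?E i) (kron (1\<^sub>m n) (A i))) {1..j}"
      by (rule mat_sum_cong)
    ultimately show ?thesis by simp
  qed
  have c: "kron (1\<^sub>m (P * n)) G \<in> carrier_mat (P * n * K) (P * n * K)"
    "kron (kron (1\<^sub>m P) (Bx (Suc j))) (A (Suc j)) \<in> carrier_mat (P * n * K) (P * n * K)"
    using G B A[of "Suc j"] by simp_all
  show ?case
    unfolding Pn IH[symmetric] fold_top peel
    by (rule mat_add_rotate(2)[OF c mat_sum_carrier])
qed

lemma tensor_subst_L_form:
  assumes A: "\<And>i. i \<le> m \<Longrightarrow> A i \<in> carrier_mat K K"
  shows "tensor_subst (\<Prod>k=1..m. N k) K m A (L_form m Bx d) = lmi_rec N Bx m (d \<cdot>\<^sub>m A 0) A"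
proof -
  define P where "P = (\<Prod>k=1..m. N k)"
  have "{0..m} = insert 0 {1..m}" by auto
  moreover have z: "kron (L_form m Bx d (unit_assignment 0)) (A 0) = kron (1\<^sub>m P) (d \<cdot>\<^sub>m A 0)"
    using L_form_unit_0[of m] A[of 0]
    by (simp add: P_def kron_smult_left[OF one_carrier_mat] kron_smult_right[OF one_carrier_mat])
  moreover have "kron (1\<^sub>m P) (d \<cdot>\<^sub>m A 0) \<in> carrier_mat (P * K) (P * K)" using A[of 0] by simp
  ultimately have "tensor_subst P K m A (L_form m Bx d)
     = kron (1\<^sub>m P) (d \<cdot>\<^sub>m A 0)
       + mat_sum (P * K) (\<lambda>i. kron (L_form m Bx d (unit_assignment i)) (A i)) {1..m}"
    unfolding tensor_subst_def by (simp only:) (subst mat_sum_insert, auto simp: z)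
  also have "\<dots> = lmi_rec N Bx m (d \<cdot>\<^sub>m A 0) A"
    unfolding P_def by (rule lmi_rec_eq) (use A in auto)
  finally show ?thesis by (simp add: P_def)
qed

end

section \<open>Symmetry and positivity of the recursive matrix\<close>

lemma sym_mat_lmi_rec:
  assumes "\<And>k. 1 \<le> k \<Longrightarrow> k \<le> m \<Longrightarrow> sym_mat (N k) (Bx k)"
    and "sym_mat K G" "\<And>k. 1 \<le> k \<Longrightarrow> k \<le> m \<Longrightarrow> sym_mat K (A k)"
  shows "sym_mat ((\<Prod>k=1..m. N k) * K) (lmi_rec N Bx m G A)"
  using assms
proof (induction m arbitrary: K G A)
  case (Suc m)
  have "sym_mat ((\<Prod>k=1..m. N k) * (N (Suc m) * K)) (lmi_rec N Bx (Suc m) G A)"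
    unfolding lmi_rec.simps using Suc.prems
    by (intro Suc.IH sym_mat_add sym_mat_kron sym_mat_one) auto
  then show ?case by (simp add: mult.assoc)
qed simp

text \<open>The induction hypothesis, applied to the absorbed data, quantifies over the first
  \<open>m\<close> parameters while the last tensor factor is still present. For fixed values of
  these parameters what remains is a pencil in that single factor, and
  \<open>psd_kron_pencil_iff\<close> brings in the last parameter. Positive sizes guarantee that the
  extreme eigenvalues exist.\<close>

lemma psd_lmi_rec_iff:
  assumes "\<And>k. 1 \<le> k \<Longrightarrow> k \<le> m \<Longrightarrow> 0 < N k"
    and "\<And>k. 1 \<le> k \<Longrightarrow> k \<le> m \<Longrightarrow> sym_mat (N k) (Bx k)"
    and "sym_mat K G" "\<And>k. 1 \<le> k \<Longrightarrow> k \<le> m \<Longrightarrow> sym_mat K (A k)"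
  shows "psd (lmi_rec N Bx m G A) \<longleftrightarrow>
    (\<forall>t. (\<forall>k\<in>{1..m}. lambda_min (Bx k) \<le> t k \<and> t k \<le> lambda_max (Bx k))
      \<longrightarrow> psd (G + mat_sum K (\<lambda>k. t k \<cdot>\<^sub>m A k) {1..m}))"
  using assms
proof (induction m arbitrary: K G A)
  case 0
  then show ?case using sym_matD(1)[OF 0(3)] by (simp add: mat_sum_empty)
next
  case (Suc m)
  define n where "n = N (Suc m)"
  define B where "B = Bx (Suc m)"
  define box where "box m t \<longleftrightarrow> (\<forall>k\<in>{1..m}. lambda_min (Bx k) \<le> t k \<and> t k \<le> lambda_max (Bx k))"
    for m and t :: "nat \<Rightarrow> real"
  define S where "S m t = mat_sum K (\<lambda>k. t k \<cdot>\<^sub>m A k) {1..m}" for m and t :: "nat \<Rightarrow> real"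
  have B: "sym_mat n B" and n: "0 < n" using Suc.prems by (auto simp: n_def B_def)
  note G = Suc.prems(3)
  have A: "sym_mat K (A k)" if "1 \<le> k" "k \<le> Suc m" for k using Suc.prems(4) that by simp
  note Gc = sym_matD(1)[OF G] and Ac = sym_matD(1)[OF A]
  have S: "sym_mat K (S m t)" for t
    unfolding S_def using A by (intro sym_mat_mat_sum sym_mat_smult) auto
  have boxSuc: "box (Suc m) t \<longleftrightarrow> box m t \<and> lambda_min B \<le> t (Suc m) \<and> t (Suc m) \<le> lambda_max B" for t
    by (auto simp: box_def B_def le_Suc_eq)
  have SSuc: "S (Suc m) t = t (Suc m) \<cdot>\<^sub>m A (Suc m) + S m t" for t
  proof -
    have "{1..Suc m} = insert (Suc m) {1..m}" by auto
    then show ?thesis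
      unfolding S_def using Ac[of "Suc m"] by (simp only:) (subst mat_sum_insert, auto)
  qed
  have "psd (lmi_rec N Bx (Suc m) G A) \<longleftrightarrow> (\<forall>t. box m t \<longrightarrow>
      psd (kron (1\<^sub>m n) G + kron B (A (Suc m)) + mat_sum (n * K) (\<lambda>k. t k \<cdot>\<^sub>m kron (1\<^sub>m n) (A k)) {1..m}))"
    unfolding lmi_rec.simps box_def n_def[symmetric] B_def[symmetric]
    using Suc.prems B A
    by (intro Suc.IH sym_mat_add sym_mat_kron sym_mat_one) auto
  \<comment> \<open>All absorbed coefficients share the left factor \<open>1\<^sub>m n\<close>, so
    the parameter sum can be pulled inside next to \<open>G\<close>.\<close>
  also have "\<dots> \<longleftrightarrow> (\<forall>t. box m t \<longrightarrow> psd (kron (1\<^sub>m n) (G + S m t) + kron B (A (Suc m))))"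
  proof -
    have "kron (1\<^sub>m n) G + kron B (A (Suc m)) + mat_sum (n * K) (\<lambda>k. t k \<cdot>\<^sub>m kron (1\<^sub>m n) (A k)) {1..m}
      = kron (1\<^sub>m n) (G + S m t) + kron B (A (Suc m))" for t
    proof -
      have "mat_sum (n * K) (\<lambda>k. t k \<cdot>\<^sub>m kron (1\<^sub>m n) (A k)) {1..m}
          = mat_sum (n * K) (\<lambda>k. kron (1\<^sub>m n) (t k \<cdot>\<^sub>m A k)) {1..m}"
        using Ac by (intro mat_sum_cong kron_smult_right[of _ n n _ K K, symmetric]) auto
      also have "\<dots> = kron (1\<^sub>m n) (S m t)"
        unfolding S_def using Ac by (intro kron_mat_sum_right[symmetric]) auto
      finally have *: "mat_sum (n * K) (\<lambda>k. t k \<cdot>\<^sub>m kron (1\<^sub>m n) (A k)) {1..m} = kron (1\<^sub>m n) (S m t)" .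
      have c: "kron (1\<^sub>m n) G \<in> carrier_mat (n * K) (n * K)"
        "kron (1\<^sub>m n) (S m t) \<in> carrier_mat (n * K) (n * K)"
        "kron B (A (Suc m)) \<in> carrier_mat (n * K) (n * K)"
        using Gc sym_matD(1)[OF S] sym_matD(1)[OF B] Ac[of "Suc m"] by simp_all
      show ?thesis
        unfolding * kron_add_right[OF one_carrier_mat Gc sym_matD(1)[OF S]]
        using mat_add_rotate[OF c(1,2,3)] mat_add_rotate(2)[OF c(1,3,2)] mat_add_rotate(1)[OF c(1,2,3)]
        by (metis c comm_add_mat)
    qed
    then show ?thesis by simp
  qed
  also have "\<dots> \<longleftrightarrow> (\<forall>t. box m t \<longrightarrow> (\<forall>s. lambda_min B \<le> s \<and> s \<le> lambda_max B \<longrightarrow>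
      psd (G + S m t + s \<cdot>\<^sub>m A (Suc m))))"
    using psd_kron_pencil_iff[OF n B sym_mat_add[OF G S] A[of "Suc m"]] by simp
  also have "\<dots> \<longleftrightarrow> (\<forall>t. box (Suc m) t \<longrightarrow> psd (G + S (Suc m) t))"
  proof -
    have eq: "G + S (Suc m) t = G + S m t + t (Suc m) \<cdot>\<^sub>m A (Suc m)" for t
      unfolding SSuc using Gc sym_matD(1)[OF S] Ac[of "Suc m"] by (intro mat_add_rotate(1)) auto
    \<comment> \<open>Neither \<open>box m\<close> nor \<open>S m\<close> looks at coordinate
      \<open>Suc m\<close>, so a separate value \<open>s\<close> can be stored there and the two
      quantifiers merge.\<close>
    have upd: "box m (t(Suc m := s)) = box m t" "S m (t(Suc m := s)) = S m t" for t s
      by (auto simp: box_def S_def intro!: mat_sum_cong)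
    show ?thesis
    proof
      assume "\<forall>t. box m t \<longrightarrow> (\<forall>s. lambda_min B \<le> s \<and> s \<le> lambda_max B \<longrightarrow> psd (G + S m t + s \<cdot>\<^sub>m A (Suc m)))"
      then show "\<forall>t. box (Suc m) t \<longrightarrow> psd (G + S (Suc m) t)"
        unfolding eq boxSuc by blast
    next
      assume R: "\<forall>t. box (Suc m) t \<longrightarrow> psd (G + S (Suc m) t)"
      show "\<forall>t. box m t \<longrightarrow> (\<forall>s. lambda_min B \<le> s \<and> s \<le> lambda_max B \<longrightarrow> psd (G + S m t + s \<cdot>\<^sub>m A (Suc m)))"
      proof (intro allI impI)
        fix t s assume "box m t" "lambda_min B \<le> s \<and> s \<le> lambda_max B"
        then show "psd (G + S m t + s \<cdot>\<^sub>m A (Suc m))"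
          using R[rule_format, of "t(Suc m := s)"] unfolding eq boxSuc upd by simp
      qed
    qed
  qed
  finally show ?case by (simp add: box_def S_def)
qed

section \<open>Semialgebraicity\<close>

lemma spectrum_nonneg_if_psd:
  assumes M: "M \<in> carrier_mat n n" and psd: "psd M" and e: "e \<in> spectrum M"
  shows "0 \<le> e"
proof -
  obtain x where x: "x \<in> carrier_vec n" "x \<noteq> 0\<^sub>v n" "M *\<^sub>v x = e \<cdot>\<^sub>v x"
    using e M by (auto simp: spectrum_def eigenvalue_def eigenvector_def)
  have "0 \<le> scalar_prod x (M *\<^sub>v x)" using psd x M by (auto simp: psd_def)
  then have "0 \<le> e * scalar_prod x x" using x by simp
  moreover have "0 < scalar_prod x x"
    using scalar_prod_self_eq_0[OF x(1)] scalar_prod_self_nonneg[of x] x(2) by linarith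
  ultimately show ?thesis by (simp add: zero_le_mult_iff)
qed

lemma coeff_prod_nonneg:
  fixes p :: "'i \<Rightarrow> real poly"
  assumes "\<And>i k. i \<in> I \<Longrightarrow> 0 \<le> coeff (p i) k"
  shows "0 \<le> coeff (\<Prod>i\<in>I. p i) k"
  using assms
proof (induction I arbitrary: k rule: infinite_finite_induct)
  case (insert i I)
  then show ?case by (auto simp: coeff_mult intro!: sum_nonneg mult_nonneg_nonneg)
qed (auto simp: coeff_1)

text \<open>All roots of the characteristic polynomial are real, so the sign of the eigenvalues can be read
  off the coefficients.\<close>

lemma psd_iff_char_poly_coeff:
  assumes sym: "sym_mat n M"
  shows "psd M \<longleftrightarrow> (\<forall>k\<le>n. 0 \<le> coeff (char_poly (- M)) k)"
proof -
  note M = sym_matD(1)[OF sym]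
  obtain d u where d: "\<And>l. l < n \<Longrightarrow> d l \<in> spectrum M"
    and du: "\<And>i j. i < n \<Longrightarrow> j < n \<Longrightarrow> (\<Sum>l<n. d l * (u l i * u l j)) = M $$ (i, j)"
    and cp: "char_poly (- M) = (\<Prod>l<n. [:d l, 1:])"
    by (rule spectral_expansion[OF sym], rule that)
  show ?thesis
  proof
    assume "psd M"
    then have "0 \<le> d l" if "l < n" for l using spectrum_nonneg_if_psd[OF M] d that by blast
    then show "\<forall>k\<le>n. 0 \<le> coeff (char_poly (- M)) k"
      unfolding cp by (auto intro!: coeff_prod_nonneg simp: coeff_pCons split: nat.split)
  next
    assume nn: "\<forall>k\<le>n. 0 \<le> coeff (char_poly (- M)) k"
    have deg: "degree (char_poly (- M)) = n" "coeff (char_poly (- M)) n = 1"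
      using degree_monic_char_poly[of "- M" n] M by auto
    have d0: "0 \<le> d l" if l: "l < n" for l
    proof (rule ccontr)
      assume "\<not> 0 \<le> d l"
      then have pos: "0 < - d l" by simp
      \<comment> \<open>At a positive point the leading term of a monic polynomial with nonnegative
        coefficients is already a positive lower bound, yet \<open>- d l\<close> is a root.\<close>
      have "0 < (- d l) ^ n" using pos by simp
      also have "\<dots> \<le> (\<Sum>k\<le>n. coeff (char_poly (- M)) k * (- d l) ^ k)"
        using nn pos deg(2) member_le_sum[of n "{..n}" "\<lambda>k. coeff (char_poly (- M)) k * (- d l) ^ k"]
        by (simp add: less_imp_le)
      also have "\<dots> = poly (char_poly (- M)) (- d l)" by (simp add: poly_altdef deg)
      also have "\<dots> = 0" unfolding cp using l by (auto simp: poly_prod intro!: prod_zero bexI[of _ l])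
      finally show False by simp
    qed
    have "quad_form n (\<lambda>i j. M $$ (i, j)) v = (\<Sum>l<n. d l * (\<Sum>i<n. u l i * v i)\<^sup>2)" for v
    proof -
      have "quad_form n (\<lambda>i j. M $$ (i, j)) v
          = (\<Sum>i<n. \<Sum>j<n. \<Sum>l<n. d l * (u l i * v i * (u l j * v j)))"
        unfolding quad_form_def
        by (intro sum.cong refl) (simp add: du[symmetric] sum_distrib_left mult_ac)
      also have "\<dots> = (\<Sum>l<n. \<Sum>i<n. \<Sum>j<n. d l * (u l i * v i * (u l j * v j)))"
        by (rule HOL.sym, rule trans[OF sum.swap], rule sum.cong[OF refl], rule sum.swap)
      also have "\<dots> = (\<Sum>l<n. d l * (\<Sum>i<n. u l i * v i)\<^sup>2)"
        unfolding power2_eq_square sum_product unfolding sum_distrib_left ..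
      finally show ?thesis .
    qed
    then show "psd M"
      unfolding psd_iff_quad_form[OF M] using sym d0 by (auto intro!: sum_nonneg mult_nonneg_nonneg)
  qed
qed

lemma real_polynomial_function_coeff_mult:
  assumes "\<And>k. real_polynomial_function (\<lambda>z. coeff (p z) k)"
    and "\<And>k. real_polynomial_function (\<lambda>z. coeff (q z) k)"
  shows "real_polynomial_function (\<lambda>z. coeff (p z * q z) k)"
  unfolding coeff_mult using assms
  by (intro real_polynomial_function_sum real_polynomial_function.intros(4)) auto

lemma real_polynomial_function_coeff_prod:
  assumes "finite I" "\<And>i k. i \<in> I \<Longrightarrow> real_polynomial_function (\<lambda>z. coeff (p i z) k)"
  shows "real_polynomial_function (\<lambda>z. coeff (\<Prod>i\<in>I. p i z) k)"
  using assms
proof (induction I arbitrary: k rule: finite_induct)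
  case (insert i I)
  then show ?case by (simp add: real_polynomial_function_coeff_mult)
qed (auto intro: real_polynomial_function.intros(2))

text \<open>The Leibniz formula writes the determinant as a signed sum of products of entries of
  \<open>X - L z\<close>, and polynomial dependence of coefficients on \<open>z\<close> survives
  sums and products.\<close>

lemma real_polynomial_function_coeff_char_poly:
  assumes L: "\<And>z. L z \<in> carrier_mat n n"
    and ent: "\<And>i j. i < n \<Longrightarrow> j < n \<Longrightarrow> real_polynomial_function (\<lambda>z. L z $$ (i, j))"
  shows "real_polynomial_function (\<lambda>z. coeff (char_poly (L z)) k)"
proof -
  have eq: "char_poly (L z) = (\<Sum>p | p permutes {0..<n}. signof p *
      (\<Prod>i = 0..<n. char_poly_matrix (L z) $$ (i, p i)))" for z
    unfolding char_poly_def using L by (intro det_def') simp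
  have cm: "real_polynomial_function (\<lambda>z. coeff (char_poly_matrix (L z) $$ (i, j)) k)"
    if ij: "i < n" "j < n" for i j k
  proof -
    \<comment> \<open>The dependence on \<open>z\<close> sits in the constant coefficient alone; the
      part coming from \<open>X\<close> is a constant function of \<open>z\<close>.\<close>
    have "coeff (char_poly_matrix (L z) $$ (i, j)) k
        = coeff (if i = j then [:0, 1:] else 0) k + (if k = 0 then -1 else 0) * L z $$ (i, j)" for z
      using L[of z] ij by (auto simp: char_poly_matrix_def coeff_pCons split: nat.split)
    then show ?thesis
      using ent[OF ij] by (simp only:) (intro real_polynomial_function.intros(2-4))
  qed
  show ?thesis
    unfolding eq coeff_sum
    by (intro real_polynomial_function_sum real_polynomial_function_coeff_mult
        real_polynomial_function_coeff_prod cm)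
      (auto intro: real_polynomial_function.intros(2) finite_permutations simp: permutes_in_image[THEN iffD2]
        dest: permutes_in_image)
qed

lemma semialgebraic_nonneg:
  assumes "real_polynomial_function p"
  shows "semialgebraic {z. 0 \<le> p z}"
proof -
  have "real_polynomial_function (\<lambda>z. (-1) * p z)"
    using assms by (intro real_polynomial_function.intros(2,4))
  then have "semialgebraic (- {z. (-1) * p z > 0})"
    by (intro semialgebraic.intros)
  then show ?thesis by (simp add: Collect_neg_eq[symmetric] not_less)
qed

lemma semialgebraic_INT:
  fixes S :: "'i \<Rightarrow> 'a::euclidean_space set"
  assumes "finite I" "\<And>i. i \<in> I \<Longrightarrow> semialgebraic (S i)"
  shows "semialgebraic (\<Inter>i\<in>I. S i)"
  using assms
proof (induction I rule: finite_induct)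
  case empty
  have "semialgebraic {z. (\<lambda>_ :: 'a. 1 :: real) z > 0}"
    by (intro semialgebraic.intros(1) real_polynomial_function.intros(2))
  then show ?case by simp
qed (auto intro: semialgebraic.intros)

lemma semialgebraic_psd:
  assumes L: "\<And>z. sym_mat n (L z)"
    and ent: "\<And>i j. i < n \<Longrightarrow> j < n \<Longrightarrow> real_polynomial_function (\<lambda>z. L z $$ (i, j))"
  shows "semialgebraic {z. psd (L z)}"
proof -
  have "real_polynomial_function (\<lambda>z. coeff (char_poly (- L z)) k)" for k
  proof (rule real_polynomial_function_coeff_char_poly)
    fix i j assume ij: "i < n" "j < n"
    have "real_polynomial_function (\<lambda>z. (-1) * L z $$ (i, j))"
      using ent[OF ij] by (intro real_polynomial_function.intros(2,4))
    then show "real_polynomial_function (\<lambda>z. (- L z) $$ (i, j))"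
      using ij by (simp add: carrier_matD[OF sym_matD(1)[OF L]])
  qed (use sym_matD(1)[OF L] in simp)
  then have "semialgebraic (\<Inter>k\<in>{..n}. {z. 0 \<le> coeff (char_poly (- L z)) k})"
    by (intro semialgebraic_INT semialgebraic_nonneg) auto
  also have "(\<Inter>k\<in>{..n}. {z. 0 \<le> coeff (char_poly (- L z)) k}) = {z. psd (L z)}"
    using psd_iff_char_poly_coeff[OF L] by auto
  finally show ?thesis .
qed

section \<open>Affine matrix functions\<close>

text \<open>Imposed on each matrix entry, this one property yields convexity, polynomial dependence
  and the explicit coefficient matrices.\<close>

definition affine_fn :: "('a::real_vector \<Rightarrow> real) \<Rightarrow> bool" where
  "affine_fn f \<longleftrightarrow> (\<exists>c g. linear g \<and> f = (\<lambda>z. c + g z))"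

lemma affine_fn_linear: "linear f \<Longrightarrow> affine_fn f"
  unfolding affine_fn_def by (intro exI[of _ 0] exI[of _ f]) auto

lemma affine_fn_const: "affine_fn (\<lambda>z. c)"
  unfolding affine_fn_def by (intro exI[of _ c] exI[of _ "\<lambda>_. 0"]) (auto simp: linear_iff)

lemma affine_fn_add: "affine_fn f \<Longrightarrow> affine_fn g \<Longrightarrow> affine_fn (\<lambda>z. f z + g z)"
proof -
  assume "affine_fn f" "affine_fn g"
  then obtain c g' d h' where *: "linear g'" "f = (\<lambda>z. c + g' z)" "linear h'" "g = (\<lambda>z. d + h' z)"
    unfolding affine_fn_def by blast
  show ?thesis
    unfolding affine_fn_def
    by (intro exI[of _ "c + d"] exI[of _ "\<lambda>z. g' z + h' z"]) (auto simp: * linear_compose_add)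
qed

lemma affine_fn_cmult: "affine_fn f \<Longrightarrow> affine_fn (\<lambda>z. a * f z)"
proof -
  assume "affine_fn f"
  then obtain c g where *: "linear g" "f = (\<lambda>z. c + g z)"
    unfolding affine_fn_def by blast
  show ?thesis
    unfolding affine_fn_def using linear_compose_scale_right[OF *(1), of a]
    by (intro exI[of _ "a * c"] exI[of _ "\<lambda>z. a * g z"]) (auto simp: * algebra_simps)
qed

lemma affine_fn_multc: "affine_fn f \<Longrightarrow> affine_fn (\<lambda>z. f z * a)"
  using affine_fn_cmult[of f a] by (simp add: mult.commute)

lemma affine_fn_sum:
  "(\<And>i. i \<in> I \<Longrightarrow> affine_fn (f i)) \<Longrightarrow> affine_fn (\<lambda>z. \<Sum>i\<in>I. f i z)"
  by (induction I rule: infinite_finite_induct) (auto intro: affine_fn_const affine_fn_add)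

lemma affine_fn_combination:
  assumes "affine_fn f" "u + v = 1"
  shows "f (u *\<^sub>R x + v *\<^sub>R y) = u * f x + v * f y"
proof -
  obtain c g where *: "linear g" "f = (\<lambda>z. c + g z)"
    using assms unfolding affine_fn_def by blast
  have "g (u *\<^sub>R x + v *\<^sub>R y) = u * g x + v * g y"
    using *(1) by (simp add: linear_add linear_scale)
  moreover have "c = u * c + v * c"
    using assms(2) by (simp add: distrib_right[symmetric])
  ultimately show ?thesis by (simp add: *(2) algebra_simps)
qed

lemma affine_fn_expansion:
  fixes f :: "'a::euclidean_space \<Rightarrow> real"
  assumes "affine_fn f"
  shows "f z = f 0 + (\<Sum>b\<in>Basis. inner z b * (f b - f 0))"
proof -
  obtain c g where *: "linear g" "f = (\<lambda>z. c + g z)"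
    using assms unfolding affine_fn_def by blast
  have "g z = g (\<Sum>b\<in>Basis. inner z b *\<^sub>R b)" by (simp add: euclidean_representation)
  also have "\<dots> = (\<Sum>b\<in>Basis. inner z b * g b)"
    by (simp add: linear_sum[OF *(1)] linear_scale[OF *(1)])
  finally show ?thesis by (simp add: *(2) linear_0[OF *(1)])
qed

lemma affine_fn_imp_real_polynomial_function:
  fixes f :: "'a::euclidean_space \<Rightarrow> real"
  assumes "affine_fn f"
  shows "real_polynomial_function f"
  using assms unfolding affine_fn_def
  by (auto intro!: real_polynomial_function.intros(3)[OF real_polynomial_function.intros(2,1)] simp: linear_conv_bounded_linear)

text \<open>An affine function is determined by its values at 0 and at the basis vectors. The
  coefficient matrices are therefore the differences \<open>L b - L 0\<close>, which inherit
  symmetry from the values of \<open>L\<close>.\<close>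

lemma sym_linear_matrix_polyI:
  fixes L :: "'a::euclidean_space \<Rightarrow> real mat"
  assumes sym: "\<And>z. sym_mat n (L z)"
    and aff: "\<And>i j. i < n \<Longrightarrow> j < n \<Longrightarrow> affine_fn (\<lambda>z. L z $$ (i, j))"
  shows "sym_linear_matrix_poly n L"
  unfolding sym_linear_matrix_poly_def
proof (rule exI[of _ "L 0"], rule exI[of _ "\<lambda>b. L b + (- 1) \<cdot>\<^sub>m L 0"], intro conjI ballI allI)
  fix b :: 'a
  show "sym_mat n (L b + (- 1) \<cdot>\<^sub>m L 0)"
    by (intro sym_mat_add sym_mat_smult sym)
next
  fix z
  show "L z = L 0 + mat_sum n (\<lambda>b. inner z b \<cdot>\<^sub>m (L b + (- 1) \<cdot>\<^sub>m L 0)) Basis"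
  proof (rule eq_matI)
    fix i j assume "i < dim_row (L 0 + mat_sum n (\<lambda>b. inner z b \<cdot>\<^sub>m (L b + (- 1) \<cdot>\<^sub>m L 0)) Basis)"
      "j < dim_col (L 0 + mat_sum n (\<lambda>b. inner z b \<cdot>\<^sub>m (L b + (- 1) \<cdot>\<^sub>m L 0)) Basis)"
    then have ij: "i < n" "j < n" by (auto simp: mat_sum_def)
    have dim: "dim_row (L w) = n" "dim_col (L w) = n" for w using sym_matD(1)[OF sym, of w] by auto
    show "L z $$ (i, j) = (L 0 + mat_sum n (\<lambda>b. inner z b \<cdot>\<^sub>m (L b + (- 1) \<cdot>\<^sub>m L 0)) Basis) $$ (i, j)"
      using ij by (subst affine_fn_expansion[OF aff[OF ij], of z]) (simp add: mat_sum_def dim)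
  qed (use sym_matD(1)[OF sym, of z] in \<open>auto simp: mat_sum_def\<close>)
qed (rule sym)

text \<open>For a fixed vector the quadratic form is affine in the point, so it takes a convex
  combination of points to the same combination of nonnegative values.\<close>

lemma convex_psd:
  fixes L :: "'a::real_vector \<Rightarrow> real mat"
  assumes sym: "\<And>z. sym_mat n (L z)"
    and aff: "\<And>i j. i < n \<Longrightarrow> j < n \<Longrightarrow> affine_fn (\<lambda>z. L z $$ (i, j))"
  shows "convex {z. psd (L z)}"
proof (rule convexI)
  fix x y and u v :: real
  assume xy: "x \<in> {z. psd (L z)}" "y \<in> {z. psd (L z)}" and uv: "0 \<le> u" "0 \<le> v" "u + v = 1"
  let ?q = "\<lambda>z. quad_form n (\<lambda>i j. L z $$ (i, j))"
  have psd: "psd (L z) \<longleftrightarrow> (\<forall>w. 0 \<le> ?q z w)" for z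
    using psd_iff_quad_form[OF sym_matD(1)[OF sym]] sym by simp
  have "?q (u *\<^sub>R x + v *\<^sub>R y) w = u * ?q x w + v * ?q y w" for w
    unfolding quad_form_linear[symmetric]
    using affine_fn_combination[OF aff uv(3)] by (intro quad_form_cong) auto
  then show "u *\<^sub>R x + v *\<^sub>R y \<in> {z. psd (L z)}"
    using xy uv by (simp add: psd)
qed

text \<open>The coefficients \<open>A k\<close> do not depend on the point. Each absorption
  multiplies an affine entry by a constant and never two affine entries, which keeps the degree at
  most one.\<close>

lemma affine_fn_lmi_rec:
  assumes "\<And>k z. 1 \<le> k \<Longrightarrow> k \<le> m \<Longrightarrow> Bx z k \<in> carrier_mat (N k) (N k)"
    and "\<And>k i j. 1 \<le> k \<Longrightarrow> k \<le> m \<Longrightarrow> i < N k \<Longrightarrow> j < N k \<Longrightarrow> affine_fn (\<lambda>z. Bx z k $$ (i, j))"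
    and "\<And>z. G z \<in> carrier_mat K K"
    and "\<And>i j. i < K \<Longrightarrow> j < K \<Longrightarrow> affine_fn (\<lambda>z. G z $$ (i, j))"
    and "\<And>k. 1 \<le> k \<Longrightarrow> k \<le> m \<Longrightarrow> A k \<in> carrier_mat K K"
    and "p < (\<Prod>k=1..m. N k) * K" "q < (\<Prod>k=1..m. N k) * K"
  shows "affine_fn (\<lambda>z. lmi_rec N (Bx z) m (G z) A $$ (p, q))"
  using assms
proof (induction m arbitrary: K G A)
  case (Suc m)
  define n where "n = N (Suc m)"
  have B: "Bx z (Suc m) \<in> carrier_mat n n" for z using Suc.prems(1) by (simp add: n_def)
  have Baff: "affine_fn (\<lambda>z. Bx z (Suc m) $$ (i, j))" if "i < n" "j < n" for i j
    using Suc.prems(2)[of "Suc m"] that by (simp add: n_def)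
  note G = Suc.prems(3) and Gaff = Suc.prems(4)
  have A: "A (Suc m) \<in> carrier_mat K K" using Suc.prems(5) by simp
  show ?case
    unfolding lmi_rec.simps n_def[symmetric]
  proof (rule Suc.IH[where K = "n * K"])
    fix i j assume ij: "i < n * K" "j < n * K"
    note d = div_mod_less[OF ij(1)] div_mod_less[OF ij(2)]
    have "(kron (1\<^sub>m n) (G z) + kron (Bx z (Suc m)) (A (Suc m))) $$ (i, j)
      = 1\<^sub>m n $$ (i div K, j div K) * G z $$ (i mod K, j mod K)
        + Bx z (Suc m) $$ (i div K, j div K) * A (Suc m) $$ (i mod K, j mod K)" for z
      using ij kron_carrier[OF B A, of z]
      by (simp add: kron_index'[OF one_carrier_mat G] kron_index'[OF B A] del: index_one_mat)
    then show "affine_fn (\<lambda>z. (kron (1\<^sub>m n) (G z) + kron (Bx z (Suc m)) (A (Suc m))) $$ (i, j))"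
      using d by (simp only:) (intro affine_fn_add affine_fn_cmult affine_fn_multc Baff Gaff)
  qed (use Suc.prems G B A in \<open>auto simp: n_def mult.assoc\<close>)
qed simp

section \<open>Application to the given pencils\<close>

lemma sym_mat_pencil:
  assumes "sym_mat n B0" "\<And>i. sym_mat n (B i)"
  shows "sym_mat n (pencil n B0 B x)"
  unfolding pencil_def using assms by (intro sym_mat_add sym_mat_mat_sum sym_mat_smult)

lemma affine_fn_pencil:
  assumes "sym_mat n B0" "\<And>k. sym_mat n (B k)" "i < n" "j < n"
  shows "affine_fn (\<lambda>z. pencil n B0 B (fst z) $$ (i, j))"
proof -
  have "pencil n B0 B x $$ (i, j) = B0 $$ (i, j) + (\<Sum>k\<in>UNIV. vec_nth x k * B k $$ (i, j))" for x
    using assms(3,4)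
    by (simp add: pencil_def mat_sum_def carrier_matD[OF sym_matD(1)[OF assms(1)]]
        carrier_matD[OF sym_matD(1)[OF assms(2)]])
  moreover have "linear (\<lambda>z :: (real ^ 'a) \<times> 'b. vec_nth (fst z) k)" for k
    by (auto simp: linear_iff)
  ultimately show ?thesis
    by (simp only:) (intro affine_fn_add affine_fn_const affine_fn_sum affine_fn_multc affine_fn_linear)
qed

theorem theorem3p2:
  fixes m :: nat and N :: "nat \<Rightarrow> nat"
    and A :: "nat \<Rightarrow> real mat"
    and B0 :: "nat \<Rightarrow> real mat" and B :: "nat \<Rightarrow> 'n::finite \<Rightarrow> real mat"
  assumes "\<And>k. k \<le> m \<Longrightarrow> 0 < N k"
    and "\<And>k. k \<le> m \<Longrightarrow> sym_mat (N 0) (A k)"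
    and "\<And>k. 1 \<le> k \<Longrightarrow> k \<le> m \<Longrightarrow> sym_mat (N k) (B0 k)"
    and "\<And>k i. 1 \<le> k \<Longrightarrow> k \<le> m \<Longrightarrow> sym_mat (N k) (B k i)"
  shows "convex (C_set m N A B0 B)
    \<and> semialgebraic (C_set m N A B0 B)
    \<and> spectrahedron (C_set m N A B0 B)
    \<and> sym_linear_matrix_poly (\<Prod>k=0..m. N k) (L_lmi m N A B0 B)
    \<and> C_set m N A B0 B = {(x, d). psd (L_lmi m N A B0 B (x, d))}"
proof -
  define M where "M = (\<Prod>k=0..m. N k)"
  define Bx where "Bx z = (\<lambda>k. pencil (N k) (B0 k) (B k) (fst z))" for z :: "(real ^ 'n) \<times> real"
  let ?L = "L_lmi m N A B0 B"
  have Msplit: "M = (\<Prod>k=1..m. N k) * N 0"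
    by (simp add: M_def prod.atLeast_Suc_atMost mult.commute)
  have A: "A k \<in> carrier_mat (N 0) (N 0)" if "k \<le> m" for k
    using sym_matD(1)[OF assms(2)] that .
  have Bx: "sym_mat (N k) (Bx z k)" if "1 \<le> k" "k \<le> m" for z k
    unfolding Bx_def using assms(3,4) that by (intro sym_mat_pencil)
  \<comment> \<open>From here on the recursive form replaces the tensor substitution: symmetry,
    affine entries and the positivity criterion are all read off it.\<close>
  have L: "?L z = lmi_rec N (Bx z) m (snd z \<cdot>\<^sub>m A 0) A" for z
    using tensor_subst_L_form[of m "Bx z" N A "N 0" "snd z"] sym_matD(1)[OF Bx] A
    by (simp add: L_lmi_def case_prod_beta Bx_def)
  have symL: "sym_mat M (?L z)" for z
    unfolding L Msplit using Bx assms(2) by (intro sym_mat_lmi_rec sym_mat_smult) auto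
  have affL: "affine_fn (\<lambda>z. ?L z $$ (i, j))" if "i < M" "j < M" for i j
    unfolding L
  proof (rule affine_fn_lmi_rec[where K = "N 0"])
    fix k i j assume "1 \<le> k" "k \<le> m" "i < N k" "j < N k"
    then show "affine_fn (\<lambda>z. Bx z k $$ (i, j))"
      unfolding Bx_def using assms(3,4) by (intro affine_fn_pencil)
  next
    fix i j assume ij: "i < N 0" "j < N 0"
    have "linear (snd :: (real ^ 'n) \<times> real \<Rightarrow> real)" by (rule linear_snd)
    then show "affine_fn (\<lambda>z :: (real ^ 'n) \<times> real. (snd z \<cdot>\<^sub>m A 0) $$ (i, j))"
      using ij A[of 0] by (simp add: affine_fn_multc affine_fn_linear)
  qed (use A sym_matD(1)[OF Bx] that Msplit in auto)
  have C: "C_set m N A B0 B = {z. psd (?L z)}"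
  proof -
    have "psd (?L z) \<longleftrightarrow> (\<forall>t. (\<forall>k\<in>{1..m}. lambda_min (Bx z k) \<le> t k \<and> t k \<le> lambda_max (Bx z k))
      \<longrightarrow> psd (snd z \<cdot>\<^sub>m A 0 + mat_sum (N 0) (\<lambda>k. t k \<cdot>\<^sub>m A k) {1..m}))" for z
      unfolding L using assms(1,2) Bx by (intro psd_lmi_rec_iff sym_mat_smult) auto
    then show ?thesis by (auto simp: C_set_def Bx_def)
  qed
  have poly: "sym_linear_matrix_poly M ?L"
    using symL affL by (rule sym_linear_matrix_polyI)
  have "convex {z. psd (?L z)}" using symL affL by (rule convex_psd)
  moreover have "semialgebraic {z. psd (?L z)}"
    using symL affine_fn_imp_real_polynomial_function[OF affL] by (rule semialgebraic_psd)
  moreover have "spectrahedron {z. psd (?L z)}"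
    unfolding spectrahedron_def using poly by blast
  ultimately show ?thesis
    using poly unfolding C M_def by auto
qed

end
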